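(* Let $G\colon\mathsf{SKB}\to\mathsf{RadRng}$ be the reflector from skew braces to radical rings. Let $B$ be a skew brace, let $P$ be the free skew brace on the underlying set of $B$, and let $$0\to K\to P\xrightarrow{\,p\,} B\to 0$$ be the corresponding free presentation, where $p$ is the canonical surjection and $K=\operatorname{Ker}(p)$. Then the second homology radical ring of $B$ with coefficients in $G$ is given by the Hopf formula $$\mathsf{H}_2(B,G)\cong\frac{K\cap[P,P]_{\mathsf{RadRng}}}{[K,P]_{\mathsf{RadRng}}}.$$
   Context: A skew brace is a triple $(A,+,\circ)$ where $(A,+)$ and $(A,\circ)$ are groups such that $a\circ(b+c)=a\circ b-a+a\circ c$ for all $a,b,c\in A$. $\mathsf{SKB}$ is the category (variety) of skew braces. Put $a*b=-a+a\circ b-b$. An ideal of $A$ is a normal subgroup $I$ of $(A,+)$ with $a*x, x*a\in I$ for all $a\in A$, $x\in I$. The right distributor of $a,b,c\in A$ is $[a,b,c]=(a+b)\circ c-b\circ c+c-a\circ c$. For an ideal $I$ of $A$, $[I,A]_{\mathsf{RadRng}}$ is the subgroup of $(A,+)$ generated by the elements $[a,b,c]$, $[c,a,b]$, $[b,c,a]$ and $a+b-a-b$ for all $a\in I$, $b,c\in A$; it is an ideal of $A$. $\mathsf{RadRng}$ is identified with the full subcategory of $\mathsf{SKB}$ of skew braces satisfying $(a+b)\circ c=a\circ c-c+b\circ c$ and $a+b=b+a$; the reflector $G$, left adjoint to the inclusion, is $G(A)=A/[A,A]_{\mathsf{RadRng}}$. Comonadic homology: let $(T,\epsilon,\delta)$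 be the comonad on $\mathsf{SKB}$ induced by the adjunction between the forgetful functor to sets and the free skew brace functor, so $T(B)$ is the free skew brace on the underlying set of $B$ and $\epsilon_B\colon T(B)\to B$ is the canonical surjection. It yields a simplicial object $\mathbb{T}(B)$ with $n$-th term $T^{n+1}(B)$ and faces $d_i=T^{i}(\epsilon_{T^{n-i}(B)})$, $0\le i\le n$. Apply $G$ degreewise to get a simplicial object in $\mathsf{RadRng}$ and take its Moore normalization $N$ (the chain complex whose $n$-th term is the intersection of the kernels of all but one extreme face map, with differential the remaining face; the image of each differential is an ideal of the kernel of the next, and homology is the quotient). Then $\mathsf{H}_n(B,G)$, $n\ge1$, is the homology of $N(G(\mathbb{T}(B)))$ in degree $n-1$ (so that $\mathsf{H}_1(B,G)\cong G(B)$). *)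

theory Defs
  imports "HOL-Algebra.QuotRing" "HOL-Algebra.Generated_Groups"
begin

section \<open>Skew braces\<close>

text \<open>A skew brace is stored in a HOL-Algebra \<open>ring\<close> record: \<open>\<oplus>\<close> is the (not necessarily
  commutative) group operation $+$, and \<open>\<otimes>\<close> is the \<^emph>\<open>circle\<close> operation of the brace, not the
  operation $a * b$. The record operations \<open>Quot\<close>, \<open>a_kernel\<close>, \<open>ring_hom\<close> and \<open>\<simeq>\<close> do not
  presuppose a ring; on such records they are the quotient by an ideal, the kernel, the
  homomorphisms and isomorphism of skew braces.\<close>

definition skew_brace :: "'a ring \<Rightarrow> bool" where
  "skew_brace A \<longleftrightarrow> group (add_monoid A) \<and> group A \<and>
     (\<forall>a\<in>carrier A. \<forall>b\<in>carrier A. \<forall>c\<in>carrier A.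
        a \<otimes>\<^bsub>A\<^esub> (b \<oplus>\<^bsub>A\<^esub> c) = (a \<otimes>\<^bsub>A\<^esub> b \<ominus>\<^bsub>A\<^esub> a) \<oplus>\<^bsub>A\<^esub> a \<otimes>\<^bsub>A\<^esub> c)"

definition radical_ring :: "'a ring \<Rightarrow> bool" where
  "radical_ring A \<longleftrightarrow> skew_brace A \<and>
     (\<forall>a\<in>carrier A. \<forall>b\<in>carrier A. \<forall>c\<in>carrier A.
        (a \<oplus>\<^bsub>A\<^esub> b) \<otimes>\<^bsub>A\<^esub> c = (a \<otimes>\<^bsub>A\<^esub> c \<ominus>\<^bsub>A\<^esub> c) \<oplus>\<^bsub>A\<^esub> b \<otimes>\<^bsub>A\<^esub> c) \<and>
     (\<forall>a\<in>carrier A. \<forall>b\<in>carrier A. a \<oplus>\<^bsub>A\<^esub> b = b \<oplus>\<^bsub>A\<^esub> a)"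

definition radrng_iso :: "'a ring \<Rightarrow> 'b ring \<Rightarrow> bool" where
  "radrng_iso A B \<longleftrightarrow> radical_ring A \<and> radical_ring B \<and> A \<simeq> B"

definition right_distributor :: "'a ring \<Rightarrow> 'a \<Rightarrow> 'a \<Rightarrow> 'a \<Rightarrow> 'a" where
  "right_distributor A a b c =
     (((a \<oplus>\<^bsub>A\<^esub> b) \<otimes>\<^bsub>A\<^esub> c \<ominus>\<^bsub>A\<^esub> b \<otimes>\<^bsub>A\<^esub> c) \<oplus>\<^bsub>A\<^esub> c) \<ominus>\<^bsub>A\<^esub> a \<otimes>\<^bsub>A\<^esub> c"

definition radrng_commutator :: "'a ring \<Rightarrow> 'a set \<Rightarrow> 'a set" where
  "radrng_commutator A I = generate (add_monoid A)
     (\<Union>a\<in>I. \<Union>b\<in>carrier A. \<Union>c\<in>carrier A.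
        {right_distributor A a b c, right_distributor A c a b, right_distributor A b c a,
         (a \<oplus>\<^bsub>A\<^esub> b \<ominus>\<^bsub>A\<^esub> a) \<ominus>\<^bsub>A\<^esub> b})"


section \<open>The reflector to radical rings\<close>

definition G_obj :: "'a ring \<Rightarrow> 'a set ring" where
  "G_obj A = A Quot radrng_commutator A (carrier A)"

text \<open>The map \<open>G(A) \<rightarrow> G(C)\<close> induced by \<open>f : A \<rightarrow> C\<close>; the argument \<open>X\<close> is a coset.\<close>

definition G_map :: "'b ring \<Rightarrow> ('a \<Rightarrow> 'b) \<Rightarrow> 'a set \<Rightarrow> 'b set" where
  "G_map C f X = (\<Union>x\<in>X. radrng_commutator C (carrier C) +>\<^bsub>C\<^esub> f x)"


section \<open>Free skew braces\<close>

text \<open>The free skew brace on a set \<open>S\<close> is the algebra of terms with variables in \<open>S\<close>, modulo the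
  least congruence containing the skew brace identities.\<close>

datatype 'a skb_term =
    Gen 'a
  | Zero | Neg "'a skb_term" | Add "'a skb_term" "'a skb_term"
  | One | Inv "'a skb_term" | Circ "'a skb_term" "'a skb_term"

definition skb_terms :: "'a set \<Rightarrow> 'a skb_term set" where
  "skb_terms S = {t. set_skb_term t \<subseteq> S}"

inductive_set skb_cong :: "'a set \<Rightarrow> ('a skb_term \<times> 'a skb_term) set" for S where
  refl: "t \<in> skb_terms S \<Longrightarrow> (t, t) \<in> skb_cong S"
| sym: "(s, t) \<in> skb_cong S \<Longrightarrow> (t, s) \<in> skb_cong S"
| trans: "(s, t) \<in> skb_cong S \<Longrightarrow> (t, u) \<in> skb_cong S \<Longrightarrow> (s, u) \<in> skb_cong S"
| neg: "(s, t) \<in> skb_cong S \<Longrightarrow> (Neg s, Neg t) \<in> skb_cong S"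
| add: "(s, t) \<in> skb_cong S \<Longrightarrow> (s', t') \<in> skb_cong S \<Longrightarrow> (Add s s', Add t t') \<in> skb_cong S"
| inv: "(s, t) \<in> skb_cong S \<Longrightarrow> (Inv s, Inv t) \<in> skb_cong S"
| circ: "(s, t) \<in> skb_cong S \<Longrightarrow> (s', t') \<in> skb_cong S \<Longrightarrow> (Circ s s', Circ t t') \<in> skb_cong S"
| add_zero: "s \<in> skb_terms S \<Longrightarrow> (Add Zero s, s) \<in> skb_cong S"
| add_neg: "s \<in> skb_terms S \<Longrightarrow> (Add (Neg s) s, Zero) \<in> skb_cong S"
| add_assoc: "s \<in> skb_terms S \<Longrightarrow> t \<in> skb_terms S \<Longrightarrow> u \<in> skb_terms S \<Longrightarrow>
    (Add (Add s t) u, Add s (Add t u)) \<in> skb_cong S"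
| circ_one: "s \<in> skb_terms S \<Longrightarrow> (Circ One s, s) \<in> skb_cong S"
| circ_inv: "s \<in> skb_terms S \<Longrightarrow> (Circ (Inv s) s, One) \<in> skb_cong S"
| circ_assoc: "s \<in> skb_terms S \<Longrightarrow> t \<in> skb_terms S \<Longrightarrow> u \<in> skb_terms S \<Longrightarrow>
    (Circ (Circ s t) u, Circ s (Circ t u)) \<in> skb_cong S"
| brace: "s \<in> skb_terms S \<Longrightarrow> t \<in> skb_terms S \<Longrightarrow> u \<in> skb_terms S \<Longrightarrow>
    (Circ s (Add t u), Add (Add (Circ s t) (Neg s)) (Circ s u)) \<in> skb_cong S"

definition skb_class :: "'a set \<Rightarrow> 'a skb_term \<Rightarrow> 'a skb_term set" where
  "skb_class S t = skb_cong S `` {t}"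

definition free_skb :: "'a set \<Rightarrow> 'a skb_term set ring" where
  "free_skb S = \<lparr>carrier = skb_terms S // skb_cong S,
     mult = (\<lambda>X Y. \<Union>s\<in>X. \<Union>t\<in>Y. skb_class S (Circ s t)),
     one = skb_class S One,
     zero = skb_class S Zero,
     add = (\<lambda>X Y. \<Union>s\<in>X. \<Union>t\<in>Y. skb_class S (Add s t))\<rparr>"

definition free_unit :: "'a set \<Rightarrow> 'a \<Rightarrow> 'a skb_term set" where
  "free_unit S x = skb_class S (Gen x)"

primrec skb_eval :: "'b ring \<Rightarrow> ('a \<Rightarrow> 'b) \<Rightarrow> 'a skb_term \<Rightarrow> 'b" where
  "skb_eval A f (Gen x) = f x"
| "skb_eval A f Zero = \<zero>\<^bsub>A\<^esub>"
| "skb_eval A f (Neg s) = \<ominus>\<^bsub>A\<^esub> skb_eval A f s"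
| "skb_eval A f (Add s t) = skb_eval A f s \<oplus>\<^bsub>A\<^esub> skb_eval A f t"
| "skb_eval A f One = \<one>\<^bsub>A\<^esub>"
| "skb_eval A f (Inv s) = inv\<^bsub>A\<^esub> skb_eval A f s"
| "skb_eval A f (Circ s t) = skb_eval A f s \<otimes>\<^bsub>A\<^esub> skb_eval A f t"

text \<open>The homomorphism \<open>free_skb S \<rightarrow> A\<close> extending a map \<open>f : S \<rightarrow> A\<close>: all terms in a class have
  the same value.\<close>

definition free_lift :: "'b ring \<Rightarrow> ('a \<Rightarrow> 'b) \<Rightarrow> 'a skb_term set \<Rightarrow> 'b" where
  "free_lift A f X = the_elem (skb_eval A f ` X)"


subsection \<open>The universal property\<close>

lemma skb_cong_terms:
  "(s, t) \<in> skb_cong S \<Longrightarrow> s \<in> skb_terms S \<and> t \<in> skb_terms S"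
  by (induction rule: skb_cong.induct) (auto simp: skb_terms_def)

lemma equiv_skb_cong: "equiv (skb_terms S) (skb_cong S)"
proof (rule equivI)
  show "skb_cong S \<subseteq> skb_terms S \<times> skb_terms S" using skb_cong_terms by auto
  show "refl_on (skb_terms S) (skb_cong S)" by (auto intro: refl_onI skb_cong.refl)
  show "sym (skb_cong S)" by (rule symI) (rule skb_cong.sym)
  show "trans (skb_cong S)" by (rule transI) (rule skb_cong.trans)
qed

lemma skb_class_eq_iff:
  assumes "s \<in> skb_terms S" "t \<in> skb_terms S"
  shows "skb_class S s = skb_class S t \<longleftrightarrow> (s, t) \<in> skb_cong S"
  unfolding skb_class_def using eq_equiv_class_iff[OF equiv_skb_cong assms] .

lemma skb_classI: "(s, t) \<in> skb_cong S \<Longrightarrow> skb_class S s = skb_class S t"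
  using skb_class_eq_iff[of s S t] skb_cong_terms[of s t S] by simp

lemma carrier_free_skb: "carrier (free_skb S) = skb_class S ` skb_terms S"
  by (auto simp: free_skb_def quotient_def skb_class_def)

lemma skb_class_closed: "t \<in> skb_terms S \<Longrightarrow> skb_class S t \<in> carrier (free_skb S)"
  by (simp add: carrier_free_skb)

lemma free_skb_elem:
  assumes "X \<in> carrier (free_skb S)"
  obtains t where "t \<in> skb_terms S" "X = skb_class S t"
  using assms by (auto simp: carrier_free_skb)

lemma in_skb_class: "u \<in> skb_class S t \<longleftrightarrow> (t, u) \<in> skb_cong S"
  by (simp add: skb_class_def)

lemma skb_class_self: "t \<in> skb_terms S \<Longrightarrow> t \<in> skb_class S t"
  by (simp add: in_skb_class skb_cong.refl)

lemma free_skb_add: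
  assumes "s \<in> skb_terms S" "t \<in> skb_terms S"
  shows "skb_class S s \<oplus>\<^bsub>free_skb S\<^esub> skb_class S t = skb_class S (Add s t)"
proof -
  have "skb_class S (Add s' t') = skb_class S (Add s t)"
    if "s' \<in> skb_class S s" "t' \<in> skb_class S t" for s' t'
  proof (rule skb_classI[symmetric])
    show "(Add s t, Add s' t') \<in> skb_cong S"
      using that by (simp add: in_skb_class skb_cong.add)
  qed
  then have "(\<Union>s'\<in>skb_class S s. \<Union>t'\<in>skb_class S t. skb_class S (Add s' t')) =
      (\<Union>s'\<in>skb_class S s. \<Union>t'\<in>skb_class S t. skb_class S (Add s t))"
    by simp
  also have "\<dots> = skb_class S (Add s t)"
    using skb_class_self[OF assms(1)] skb_class_self[OF assms(2)]
    by (metis UN_constant empty_iff)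
  finally show ?thesis by (simp add: free_skb_def)
qed

lemma free_skb_mult:
  assumes "s \<in> skb_terms S" "t \<in> skb_terms S"
  shows "skb_class S s \<otimes>\<^bsub>free_skb S\<^esub> skb_class S t = skb_class S (Circ s t)"
proof -
  have "skb_class S (Circ s' t') = skb_class S (Circ s t)"
    if "s' \<in> skb_class S s" "t' \<in> skb_class S t" for s' t'
  proof (rule skb_classI[symmetric])
    show "(Circ s t, Circ s' t') \<in> skb_cong S"
      using that by (simp add: in_skb_class skb_cong.circ)
  qed
  then have "(\<Union>s'\<in>skb_class S s. \<Union>t'\<in>skb_class S t. skb_class S (Circ s' t')) =
      (\<Union>s'\<in>skb_class S s. \<Union>t'\<in>skb_class S t. skb_class S (Circ s t))"
    by simp
  also have "\<dots> = skb_class S (Circ s t)"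
    using skb_class_self[OF assms(1)] skb_class_self[OF assms(2)]
    by (metis UN_constant empty_iff)
  finally show ?thesis by (simp add: free_skb_def)
qed

lemma free_skb_zero: "\<zero>\<^bsub>free_skb S\<^esub> = skb_class S Zero"
  by (simp add: free_skb_def)

lemma free_skb_one: "\<one>\<^bsub>free_skb S\<^esub> = skb_class S One"
  by (simp add: free_skb_def)

lemma skb_terms_simps [simp]:
  "Gen x \<in> skb_terms S \<longleftrightarrow> x \<in> S"
  "Zero \<in> skb_terms S" "One \<in> skb_terms S"
  "Neg s \<in> skb_terms S \<longleftrightarrow> s \<in> skb_terms S"
  "Inv s \<in> skb_terms S \<longleftrightarrow> s \<in> skb_terms S"
  "Add s t \<in> skb_terms S \<longleftrightarrow> s \<in> skb_terms S \<and> t \<in> skb_terms S"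
  "Circ s t \<in> skb_terms S \<longleftrightarrow> s \<in> skb_terms S \<and> t \<in> skb_terms S"
  by (auto simp: skb_terms_def)

lemma free_skb_add_group: "group (add_monoid (free_skb S))"
proof (rule groupI, simp_all)
  show "\<zero>\<^bsub>free_skb S\<^esub> \<in> carrier (free_skb S)"
    by (simp add: free_skb_zero skb_class_closed)
next
  fix x y assume "x \<in> carrier (free_skb S)" "y \<in> carrier (free_skb S)"
  then show "x \<oplus>\<^bsub>free_skb S\<^esub> y \<in> carrier (free_skb S)"
    by (auto elim!: free_skb_elem simp: free_skb_add skb_class_closed)
next
  fix x y z
  assume "x \<in> carrier (free_skb S)" "y \<in> carrier (free_skb S)" "z \<in> carrier (free_skb S)"
  then show "x \<oplus>\<^bsub>free_skb S\<^esub> y \<oplus>\<^bsub>free_skb S\<^esub> z = x \<oplus>\<^bsub>free_skb S\<^esub> (y \<oplus>\<^bsub>free_skb S\<^esub> z)"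
    by (elim free_skb_elem) (simp add: free_skb_add skb_classI skb_cong.add_assoc)
next
  fix x assume "x \<in> carrier (free_skb S)"
  then show "\<zero>\<^bsub>free_skb S\<^esub> \<oplus>\<^bsub>free_skb S\<^esub> x = x"
    by (elim free_skb_elem) (simp add: free_skb_add free_skb_zero skb_classI skb_cong.add_zero)
next
  fix x assume "x \<in> carrier (free_skb S)"
  then obtain t where t: "t \<in> skb_terms S" "x = skb_class S t" by (rule free_skb_elem)
  show "\<exists>y\<in>carrier (free_skb S). y \<oplus>\<^bsub>free_skb S\<^esub> x = \<zero>\<^bsub>free_skb S\<^esub>"
    by (rule bexI[of _ "skb_class S (Neg t)"])
      (use t in \<open>simp_all add: free_skb_add free_skb_zero skb_class_closed skb_classI
        skb_cong.add_neg\<close>)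
qed

lemma free_skb_mult_group: "group (free_skb S)"
proof (rule groupI)
  show "\<one>\<^bsub>free_skb S\<^esub> \<in> carrier (free_skb S)"
    by (simp add: free_skb_one skb_class_closed)
next
  fix x y assume "x \<in> carrier (free_skb S)" "y \<in> carrier (free_skb S)"
  then show "x \<otimes>\<^bsub>free_skb S\<^esub> y \<in> carrier (free_skb S)"
    by (auto elim!: free_skb_elem simp: free_skb_mult skb_class_closed)
next
  fix x y z
  assume "x \<in> carrier (free_skb S)" "y \<in> carrier (free_skb S)" "z \<in> carrier (free_skb S)"
  then show "x \<otimes>\<^bsub>free_skb S\<^esub> y \<otimes>\<^bsub>free_skb S\<^esub> z = x \<otimes>\<^bsub>free_skb S\<^esub> (y \<otimes>\<^bsub>free_skb S\<^esub> z)"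
    by (elim free_skb_elem) (simp add: free_skb_mult skb_classI skb_cong.circ_assoc)
next
  fix x assume "x \<in> carrier (free_skb S)"
  then show "\<one>\<^bsub>free_skb S\<^esub> \<otimes>\<^bsub>free_skb S\<^esub> x = x"
    by (elim free_skb_elem) (simp add: free_skb_mult free_skb_one skb_classI skb_cong.circ_one)
next
  fix x assume "x \<in> carrier (free_skb S)"
  then obtain t where t: "t \<in> skb_terms S" "x = skb_class S t" by (rule free_skb_elem)
  show "\<exists>y\<in>carrier (free_skb S). y \<otimes>\<^bsub>free_skb S\<^esub> x = \<one>\<^bsub>free_skb S\<^esub>"
    by (rule bexI[of _ "skb_class S (Inv t)"])
      (use t in \<open>simp_all add: free_skb_mult free_skb_one skb_class_closed skb_classI
        skb_cong.circ_inv\<close>)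
qed

lemma free_skb_neg:
  assumes "t \<in> skb_terms S"
  shows "\<ominus>\<^bsub>free_skb S\<^esub> skb_class S t = skb_class S (Neg t)"
proof -
  have "skb_class S (Neg t) \<oplus>\<^bsub>free_skb S\<^esub> skb_class S t = \<zero>\<^bsub>free_skb S\<^esub>"
    using assms by (simp add: free_skb_add free_skb_zero skb_classI skb_cong.add_neg)
  then show ?thesis
    using assms group.inv_equality[OF free_skb_add_group[of S], of "skb_class S (Neg t)"]
    by (simp add: a_inv_def skb_class_closed)
qed

lemma free_skb_inv:
  assumes "t \<in> skb_terms S"
  shows "inv\<^bsub>free_skb S\<^esub> skb_class S t = skb_class S (Inv t)"
proof -
  have "skb_class S (Inv t) \<otimes>\<^bsub>free_skb S\<^esub> skb_class S t = \<one>\<^bsub>free_skb S\<^esub>"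
    using assms by (simp add: free_skb_mult free_skb_one skb_classI skb_cong.circ_inv)
  then show ?thesis
    using assms group.inv_equality[OF free_skb_mult_group[of S], of "skb_class S (Inv t)"]
    by (simp add: skb_class_closed)
qed

lemma skew_brace_free_skb: "skew_brace (free_skb S)"
  unfolding skew_brace_def
proof (intro conjI ballI)
  show "group (add_monoid (free_skb S))" by (rule free_skb_add_group)
  show "group (free_skb S)" by (rule free_skb_mult_group)
next
  fix a b c
  assume "a \<in> carrier (free_skb S)" "b \<in> carrier (free_skb S)" "c \<in> carrier (free_skb S)"
  then show "a \<otimes>\<^bsub>free_skb S\<^esub> (b \<oplus>\<^bsub>free_skb S\<^esub> c) =
      (a \<otimes>\<^bsub>free_skb S\<^esub> b \<ominus>\<^bsub>free_skb S\<^esub> a) \<oplus>\<^bsub>free_skb S\<^esub> a \<otimes>\<^bsub>free_skb S\<^esub> c"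
    by (elim free_skb_elem)
      (simp add: a_minus_def free_skb_add free_skb_mult free_skb_neg skb_classI skb_cong.brace)
qed

lemma free_unit_closed: "x \<in> S \<Longrightarrow> free_unit S x \<in> carrier (free_skb S)"
  by (simp add: free_unit_def skb_class_closed)

lemma skb_eval_closed:
  assumes "skew_brace A" "f \<in> S \<rightarrow> carrier A" "t \<in> skb_terms S"
  shows "skb_eval A f t \<in> carrier A"
proof -
  interpret P: group "add_monoid A" using assms(1) by (simp add: skew_brace_def)
  interpret M: group A using assms(1) by (simp add: skew_brace_def)
  from assms(3) show ?thesis
    using assms(2) P.inv_closed P.m_closed P.one_closed
    by (induction t) (auto simp: a_inv_def)
qed

lemma skb_eval_cong:
  assumes A: "skew_brace A" and f: "f \<in> S \<rightarrow> carrier A" and st: "(s, t) \<in> skb_cong S"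
  shows "skb_eval A f s = skb_eval A f t"
proof -
  interpret P: group "add_monoid A" using A by (simp add: skew_brace_def)
  interpret M: group A using A by (simp add: skew_brace_def)
  note cl = skb_eval_closed[OF A f]
  from st show ?thesis
  proof (induction rule: skb_cong.induct)
    case (add_assoc s t u)
    then show ?case using P.m_assoc cl by simp
  next
    case (add_neg s)
    then show ?case using P.l_inv cl by (simp add: a_inv_def)
  next
    case (add_zero s)
    then show ?case using P.l_one cl by simp
  next
    case (circ_assoc s t u)
    then show ?case using M.m_assoc cl by simp
  next
    case (brace s t u)
    then show ?case using A cl by (simp add: skew_brace_def a_minus_def)
  qed (auto simp: cl)
qed

lemma free_lift_class:
  assumes "skew_brace A" "f \<in> S \<rightarrow> carrier A" "t \<in> skb_terms S"
  shows "free_lift A f (skb_class S t) = skb_eval A f t"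
proof -
  have "skb_eval A f ` skb_class S t = {skb_eval A f t}"
  proof (intro equalityI subsetI)
    fix y assume "y \<in> skb_eval A f ` skb_class S t"
    then obtain s where "(t, s) \<in> skb_cong S" "y = skb_eval A f s"
      by (auto simp: in_skb_class)
    then show "y \<in> {skb_eval A f t}" using skb_eval_cong[OF assms(1,2), of t s] by simp
  next
    fix y assume "y \<in> {skb_eval A f t}"
    then show "y \<in> skb_eval A f ` skb_class S t" using skb_class_self[OF assms(3)] by simp
  qed
  then show ?thesis by (simp add: free_lift_def)
qed

lemma free_lift_unit:
  assumes "skew_brace A" "f \<in> S \<rightarrow> carrier A" "x \<in> S"
  shows "free_lift A f (free_unit S x) = f x"
  using free_lift_class[OF assms(1,2), of "Gen x"] assms(3) by (simp add: free_unit_def)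

lemma free_lift_hom:
  assumes "skew_brace A" "f \<in> S \<rightarrow> carrier A"
  shows "free_lift A f \<in> ring_hom (free_skb S) A"
  by (rule ring_hom_memI)
    (auto elim!: free_skb_elem simp: free_skb_add free_skb_mult free_skb_one
      free_lift_class[OF assms] skb_eval_closed[OF assms])

lemma free_lift_unique:
  assumes A: "skew_brace A" and h: "h \<in> ring_hom (free_skb S) A"
    and f: "\<And>x. x \<in> S \<Longrightarrow> h (free_unit S x) = f x"
    and X: "X \<in> carrier (free_skb S)"
  shows "h X = free_lift A f X"
proof -
  interpret P: group "add_monoid A" using A by (simp add: skew_brace_def)
  interpret M: group A using A by (simp add: skew_brace_def)
  have hcl: "h Y \<in> carrier A" if "Y \<in> carrier (free_skb S)" for Y
    using h that by (auto simp: ring_hom_def)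
  have fS: "f \<in> S \<rightarrow> carrier A"
    using hcl free_unit_closed f by (metis Pi_I)
  have add: "group_hom (add_monoid (free_skb S)) (add_monoid A) h"
    using h free_skb_add_group P.group_axioms
    by (auto simp: group_hom_def group_hom_axioms_def hom_def ring_hom_def)
  have mult: "group_hom (free_skb S) A h"
    using h free_skb_mult_group M.group_axioms
    by (auto simp: group_hom_def group_hom_axioms_def hom_def ring_hom_def)
  have "h (skb_class S t) = skb_eval A f t" if "t \<in> skb_terms S" for t
    using that
  proof (induction t)
    case (Gen x)
    then show ?case using f by (simp add: free_unit_def)
  next
    case Zero
    then show ?case using group_hom.hom_one[OF add] by (simp add: free_skb_zero)
  next
    case (Neg t)
    then show ?case using group_hom.hom_inv[OF add, of "skb_class S t"]
      by (simp add: skb_class_closed free_skb_neg[symmetric] a_inv_def)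
  next
    case (Add s t)
    then show ?case using group_hom.hom_mult[OF add, of "skb_class S s" "skb_class S t"]
      by (simp add: skb_class_closed free_skb_add)
  next
    case One
    then show ?case using group_hom.hom_one[OF mult] by (simp add: free_skb_one)
  next
    case (Inv t)
    then show ?case using group_hom.hom_inv[OF mult, of "skb_class S t"]
      by (simp add: skb_class_closed free_skb_inv[symmetric])
  next
    case (Circ s t)
    then show ?case using group_hom.hom_mult[OF mult, of "skb_class S s" "skb_class S t"]
      by (simp add: skb_class_closed free_skb_mult)
  qed
  then show ?thesis
    using X by (auto elim!: free_skb_elem simp: free_lift_class[OF A fS])
qed


section \<open>The comonad and its simplicial object\<close>

definition T_obj :: "'a ring \<Rightarrow> 'a skb_term set ring" where
  "T_obj B = free_skb (carrier B)"

text \<open>\<open>T(f) : T(B) \<rightarrow> T(C)\<close> for \<open>f : B \<rightarrow> C\<close>.\<close>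

definition T_map :: "'b ring \<Rightarrow> ('a \<Rightarrow> 'b) \<Rightarrow> 'a skb_term set \<Rightarrow> 'b skb_term set" where
  "T_map C f = free_lift (T_obj C) (\<lambda>x. free_unit (carrier C) (f x))"

definition T_counit :: "'a ring \<Rightarrow> 'a skb_term set \<Rightarrow> 'a" where
  "T_counit B = free_lift B (\<lambda>x. x)"

text \<open>The terms $T^{n+1}(B)$ of the simplicial object have pairwise different types. The homology
  in degree 1 only involves the terms and face maps in degrees 0, 1 and 2. The face map
  $d_i = T^i(\epsilon_{T^{n-i}(B)})$ goes from $T^{n+1}(B)$ to $T^n(B)$ for $0 \le i \le n$; its
  values for $i > n$ are irrelevant. The first argument of \<open>T_map\<close> is the codomain of the
  mapped homomorphism.\<close>

definition T_face1 :: "'a ring \<Rightarrow> nat \<Rightarrow> 'a skb_term set skb_term set \<Rightarrow> 'a skb_term set" where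
  "T_face1 B i = (if i = 0 then T_counit (T_obj B) else T_map B (T_counit B))"

definition T_face2 :: "'a ring \<Rightarrow> nat \<Rightarrow>
    'a skb_term set skb_term set skb_term set \<Rightarrow> 'a skb_term set skb_term set" where
  "T_face2 B i =
     (if i = 0 then T_counit (T_obj (T_obj B))
      else if i = 1 then T_map (T_obj B) (T_counit (T_obj B))
      else T_map (T_obj B) (T_map B (T_counit B)))"


section \<open>Moore normalization and homology\<close>

text \<open>The convention is $N_n = \bigcap_{i < n} \mathrm{Ker}(d_i)$ with differential $d_n$. Below,
  \<open>d\<close> is the family of face maps from the term \<open>X\<close> in degree \<open>n\<close> to the term \<open>Y\<close> in degree
  \<open>n - 1\<close>.\<close>

definition moore_term :: "nat \<Rightarrow> 'x ring \<Rightarrow> 'y ring \<Rightarrow> (nat \<Rightarrow> 'x \<Rightarrow> 'y) \<Rightarrow> 'x set" where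
  "moore_term n X Y d = carrier X \<inter> (\<Inter>i<n. a_kernel X Y (d i))"

text \<open>The homology in degree \<open>n \<ge> 1\<close> of a simplicial object with terms \<open>X2\<close>, \<open>X1\<close>, \<open>X0\<close> in
  degrees \<open>n + 1\<close>, \<open>n\<close>, \<open>n - 1\<close>, and face maps \<open>d2 i : X2 \<rightarrow> X1\<close> and \<open>d1 i : X1 \<rightarrow> X0\<close>.\<close>

definition moore_homology ::
    "nat \<Rightarrow> 'x ring \<Rightarrow> 'y ring \<Rightarrow> 'z ring \<Rightarrow> (nat \<Rightarrow> 'x \<Rightarrow> 'y) \<Rightarrow> (nat \<Rightarrow> 'y \<Rightarrow> 'z) \<Rightarrow> 'y set ring"
  where
  "moore_homology n X2 X1 X0 d2 d1 =
     X1\<lparr>carrier := moore_term n X1 X0 d1 \<inter> a_kernel X1 X0 (d1 n)\<rparr>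
       Quot (d2 (Suc n) ` moore_term (Suc n) X2 X1 d2)"

text \<open>$H_2(B, G)$ is the homology in degree 1 of $N(G(\mathbb{T}(B)))$.\<close>

definition H2_radrng :: "'a ring \<Rightarrow> 'a skb_term set skb_term set set set ring" where
  "H2_radrng B = moore_homology 1
     (G_obj (T_obj (T_obj (T_obj B)))) (G_obj (T_obj (T_obj B))) (G_obj (T_obj B))
     (\<lambda>i. G_map (T_obj (T_obj B)) (T_face2 B i))
     (\<lambda>i. G_map (T_obj B) (T_face1 B i))"

end

theory Submission
  imports Defs
begin

text \<open>Write \<open>X0\<close>, \<open>X1\<close>, \<open>X2\<close> for the first terms of the simplicial object, \<open>D\<close> for the commutator
  \<open>[X, X]\<close> of each, and \<open>J = [K, X0]\<close>. Modulo degenerate elements, every cycle of \<open>G(X1)\<close> is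
  represented by some \<open>u\<close> with \<open>d0 u = 0\<close> and \<open>d1 u \<in> D\<close>, and then \<open>d1 u \<in> K \<inter> D\<close>; conversely
  the extra degeneracy given by the generators of the free objects lifts all of \<open>K\<close> to \<open>Ker d0\<close>.
  So \<open>d1\<close> should induce the isomorphism. As \<open>K\<close> is central modulo \<open>J\<close>, right distributors and
  commutators do not change modulo \<open>J\<close> when an argument is moved by an element of \<open>K\<close>; since \<open>d0\<close>
  and \<open>d1\<close> differ by elements of \<open>K\<close>, they agree modulo \<open>J\<close> on \<open>[X1, X1]\<close>. Hence \<open>d1\<close> is well
  defined modulo \<open>J\<close> and kills boundaries. If \<open>d1 u \<in> J\<close>, then \<open>d1 u = d1 v\<close> for some
  \<open>v \<in> [Ker d0, X1]\<close>, because \<open>d1\<close> maps \<open>Ker d0\<close> onto \<open>K\<close>; contractibility of the simplicial object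
  makes \<open>u - v\<close>, and thus the class of \<open>u\<close>, a boundary.\<close>

section \<open>Skew braces and ideals\<close>

locale skb =
  fixes A :: "'a ring" (structure)
  assumes skew_brace: "skew_brace A"
begin

lemma add_group: "group (add_monoid A)" and mult_group: "group A"
  using skew_brace by (simp_all add: skew_brace_def)

lemma brace:
  "\<lbrakk>a \<in> carrier A; b \<in> carrier A; c \<in> carrier A\<rbrakk> \<Longrightarrow>
    a \<otimes> (b \<oplus> c) = a \<otimes> b \<oplus> (\<ominus> a \<oplus> a \<otimes> c)"
proof -
  assume abc: "a \<in> carrier A" "b \<in> carrier A" "c \<in> carrier A"
  interpret P: group "add_monoid A" by (rule add_group)
  interpret M: group A by (rule mult_group)
  have "\<ominus> a \<in> carrier A" using abc P.inv_closed by (simp add: a_inv_def)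
  moreover have "a \<otimes> b \<in> carrier A" "a \<otimes> c \<in> carrier A" using abc by simp_all
  ultimately show ?thesis
    using skew_brace abc P.m_assoc[of "a \<otimes> b" "\<ominus> a" "a \<otimes> c"]
    by (simp add: skew_brace_def a_minus_def)
qed

lemma zero_closed [simp]: "\<zero> \<in> carrier A"
  using monoid.one_closed[OF group.is_monoid[OF add_group]] by simp

lemma add_closed [simp]: "\<lbrakk>a \<in> carrier A; b \<in> carrier A\<rbrakk> \<Longrightarrow> a \<oplus> b \<in> carrier A"
  using monoid.m_closed[OF group.is_monoid[OF add_group]] by simp

lemma neg_closed [simp]: "a \<in> carrier A \<Longrightarrow> \<ominus> a \<in> carrier A"
  using group.inv_closed[OF add_group] by (simp add: a_inv_def)

lemma minus_closed [simp]: "\<lbrakk>a \<in> carrier A; b \<in> carrier A\<rbrakk> \<Longrightarrow> a \<ominus> b \<in> carrier A"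
  by (simp add: a_minus_def)

lemma one_closed [simp]: "\<one> \<in> carrier A"
  using monoid.one_closed[OF group.is_monoid[OF mult_group]] .

lemma mult_closed [simp]: "\<lbrakk>a \<in> carrier A; b \<in> carrier A\<rbrakk> \<Longrightarrow> a \<otimes> b \<in> carrier A"
  using monoid.m_closed[OF group.is_monoid[OF mult_group]] by simp

lemma minv_closed [simp]: "a \<in> carrier A \<Longrightarrow> inv a \<in> carrier A"
  using group.inv_closed[OF mult_group] by simp

lemma add_assoc:
  "\<lbrakk>a \<in> carrier A; b \<in> carrier A; c \<in> carrier A\<rbrakk> \<Longrightarrow> a \<oplus> b \<oplus> c = a \<oplus> (b \<oplus> c)"
  using monoid.m_assoc[OF group.is_monoid[OF add_group]] by simp

lemma mult_assoc:
  "\<lbrakk>a \<in> carrier A; b \<in> carrier A; c \<in> carrier A\<rbrakk> \<Longrightarrow> a \<otimes> b \<otimes> c = a \<otimes> (b \<otimes> c)"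
  using monoid.m_assoc[OF group.is_monoid[OF mult_group]] by simp

lemma add_zero [simp]: "a \<in> carrier A \<Longrightarrow> a \<oplus> \<zero> = a"
  using monoid.r_one[OF group.is_monoid[OF add_group]] by simp

lemma zero_add [simp]: "a \<in> carrier A \<Longrightarrow> \<zero> \<oplus> a = a"
  using monoid.l_one[OF group.is_monoid[OF add_group]] by simp

lemma add_neg [simp]: "a \<in> carrier A \<Longrightarrow> a \<oplus> \<ominus> a = \<zero>"
  using group.r_inv[OF add_group] by (simp add: a_inv_def)

lemma neg_add [simp]: "a \<in> carrier A \<Longrightarrow> \<ominus> a \<oplus> a = \<zero>"
  using group.l_inv[OF add_group] by (simp add: a_inv_def)

lemma add_neg_cancel [simp]: "\<lbrakk>a \<in> carrier A; b \<in> carrier A\<rbrakk> \<Longrightarrow> a \<oplus> (\<ominus> a \<oplus> b) = b"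
  by (simp add: add_assoc[symmetric])

lemma neg_add_cancel [simp]: "\<lbrakk>a \<in> carrier A; b \<in> carrier A\<rbrakk> \<Longrightarrow> \<ominus> a \<oplus> (a \<oplus> b) = b"
  by (simp add: add_assoc[symmetric])

lemma neg_neg [simp]: "a \<in> carrier A \<Longrightarrow> \<ominus> (\<ominus> a) = a"
  using group.inv_inv[OF add_group] by (simp add: a_inv_def)

lemma neg_zero [simp]: "\<ominus> \<zero> = \<zero>"
  using monoid.inv_one[OF group.is_monoid[OF add_group]] by (simp add: a_inv_def)

lemma neg_of_add: "\<lbrakk>a \<in> carrier A; b \<in> carrier A\<rbrakk> \<Longrightarrow> \<ominus> (a \<oplus> b) = \<ominus> b \<oplus> \<ominus> a"
  using group.inv_mult_group[OF add_group] by (simp add: a_inv_def)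

text \<open>Together with the simplification rules above, these rewrite to the normal form of the free
  group.\<close>

lemmas gsimps = add_assoc neg_of_add a_minus_def

lemma add_right_cancel:
  "\<lbrakk>a \<in> carrier A; b \<in> carrier A; c \<in> carrier A\<rbrakk> \<Longrightarrow> b \<oplus> a = c \<oplus> a \<longleftrightarrow> b = c"
  using group.right_cancel[OF add_group] by simp

lemma minus_eq_iff:
  "\<lbrakk>a \<in> carrier A; b \<in> carrier A; c \<in> carrier A\<rbrakk> \<Longrightarrow> a \<ominus> b = c \<longleftrightarrow> a = c \<oplus> b"
  using add_right_cancel[of b "a \<ominus> b" c] by (simp add: gsimps)

text \<open>The brace identity at \<open>a = \<one>\<close>, \<open>b = c = \<zero>\<close> leaves
  \<open>\<zero> = \<ominus> \<one>\<close>. The rules for the circle group can then be stated with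
  \<open>\<zero>\<close>.\<close>

lemma one_eq_zero: "\<one> = \<zero>"
proof -
  have "\<one> \<otimes> (\<zero> \<oplus> \<zero>) = \<one> \<otimes> \<zero> \<oplus> (\<ominus> \<one> \<oplus> \<one> \<otimes> \<zero>)"
    by (rule brace) simp_all
  then have "\<zero> = \<ominus> \<one>" using monoid.l_one[OF group.is_monoid[OF mult_group]] by simp
  then show ?thesis by (metis neg_neg neg_zero one_closed)
qed

lemma mult_zero [simp]: "a \<in> carrier A \<Longrightarrow> a \<otimes> \<zero> = a"
  using monoid.r_one[OF group.is_monoid[OF mult_group]] by (simp add: one_eq_zero)

lemma zero_mult [simp]: "a \<in> carrier A \<Longrightarrow> \<zero> \<otimes> a = a"
  using monoid.l_one[OF group.is_monoid[OF mult_group]] by (simp add: one_eq_zero)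

lemma minv_mult [simp]: "a \<in> carrier A \<Longrightarrow> inv a \<otimes> a = \<zero>"
  using group.l_inv[OF mult_group] by (simp add: one_eq_zero)

lemma mult_minv [simp]: "a \<in> carrier A \<Longrightarrow> a \<otimes> inv a = \<zero>"
  using group.r_inv[OF mult_group] by (simp add: one_eq_zero)

lemma mult_minv_cancel [simp]: "\<lbrakk>a \<in> carrier A; b \<in> carrier A\<rbrakk> \<Longrightarrow> a \<otimes> (inv a \<otimes> b) = b"
  by (simp add: mult_assoc[symmetric])

text \<open>Distribute \<open>a\<close> over \<open>b \<oplus> \<ominus> b = \<zero>\<close>, where
  \<open>a \<otimes> \<zero> = a\<close>, and solve for the last term.\<close>

lemma mult_neg: "\<lbrakk>a \<in> carrier A; b \<in> carrier A\<rbrakk> \<Longrightarrow> a \<otimes> (\<ominus> b) = a \<oplus> (\<ominus> (a \<otimes> b) \<oplus> a)"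
proof -
  assume ab: "a \<in> carrier A" "b \<in> carrier A"
  have "a \<otimes> (b \<oplus> \<ominus> b) = a \<otimes> b \<oplus> (\<ominus> a \<oplus> a \<otimes> (\<ominus> b))"
    using ab by (intro brace) auto
  then have "a = a \<otimes> b \<oplus> (\<ominus> a \<oplus> a \<otimes> (\<ominus> b))" using ab by simp
  then have "a \<oplus> (\<ominus> (a \<otimes> b) \<oplus> a) =
      a \<oplus> (\<ominus> (a \<otimes> b) \<oplus> (a \<otimes> b \<oplus> (\<ominus> a \<oplus> a \<otimes> (\<ominus> b))))" by metis
  also have "\<dots> = a \<otimes> (\<ominus> b)" using ab by simp
  finally show ?thesis by simp
qed

lemma mult_add_eq:
  "\<lbrakk>a \<in> carrier A; b \<in> carrier A; c \<in> carrier A\<rbrakk> \<Longrightarrow>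
    a \<otimes> (b \<oplus> c) = (a \<otimes> b \<ominus> a) \<oplus> a \<otimes> c"
  by (simp add: brace gsimps)

lemma right_distributor_closed [simp]:
  "\<lbrakk>a \<in> carrier A; b \<in> carrier A; c \<in> carrier A\<rbrakk> \<Longrightarrow> right_distributor A a b c \<in> carrier A"
  by (simp add: right_distributor_def)

text \<open>The right distributor is the error term of the radical ring law, split off on the
  left.\<close>

lemma add_mult_eq:
  "\<lbrakk>a \<in> carrier A; b \<in> carrier A; c \<in> carrier A\<rbrakk> \<Longrightarrow>
    (a \<oplus> b) \<otimes> c = right_distributor A a b c \<oplus> ((a \<otimes> c \<ominus> c) \<oplus> b \<otimes> c)"
  by (simp add: right_distributor_def gsimps)

end

text \<open>For a normal subgroup these conditions amount to a*x and x*a lying in \<open>I\<close>: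
  \<open>a \<otimes> x \<ominus> a\<close> is the conjugate by a of a*x + x, and
  \<open>x \<otimes> a \<ominus> a\<close> is x + x*a. In this form they say how translations by
  \<open>a\<close> move \<open>I\<close>.\<close>

definition skb_ideal :: "'a ring \<Rightarrow> 'a set \<Rightarrow> bool" where
  "skb_ideal A I \<longleftrightarrow> I \<subseteq> carrier A \<and> \<zero>\<^bsub>A\<^esub> \<in> I \<and>
     (\<forall>x\<in>I. \<ominus>\<^bsub>A\<^esub> x \<in> I) \<and> (\<forall>x\<in>I. \<forall>y\<in>I. x \<oplus>\<^bsub>A\<^esub> y \<in> I) \<and>
     (\<forall>a\<in>carrier A. \<forall>x\<in>I. (a \<oplus>\<^bsub>A\<^esub> x) \<ominus>\<^bsub>A\<^esub> a \<in> I \<and>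
        a \<otimes>\<^bsub>A\<^esub> x \<ominus>\<^bsub>A\<^esub> a \<in> I \<and> x \<otimes>\<^bsub>A\<^esub> a \<ominus>\<^bsub>A\<^esub> a \<in> I)"

section \<open>Cosets of an ideal and the quotient structure\<close>

locale skb_with_ideal = skb +
  fixes I
  assumes ideal: "skb_ideal A I"
begin

lemma I_carrier [simp]: "x \<in> I \<Longrightarrow> x \<in> carrier A"
  and I_zero [simp]: "\<zero> \<in> I"
  and I_neg [simp]: "x \<in> I \<Longrightarrow> \<ominus> x \<in> I"
  and I_add [simp]: "\<lbrakk>x \<in> I; y \<in> I\<rbrakk> \<Longrightarrow> x \<oplus> y \<in> I"
  and I_conj [simp]: "\<lbrakk>x \<in> I; a \<in> carrier A\<rbrakk> \<Longrightarrow> (a \<oplus> x) \<ominus> a \<in> I"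
  and I_mult_left [simp]: "\<lbrakk>x \<in> I; a \<in> carrier A\<rbrakk> \<Longrightarrow> a \<otimes> x \<ominus> a \<in> I"
  and I_mult_right [simp]: "\<lbrakk>x \<in> I; a \<in> carrier A\<rbrakk> \<Longrightarrow> x \<otimes> a \<ominus> a \<in> I"
  using ideal by (auto simp: skb_ideal_def)

lemma I_minus [simp]: "\<lbrakk>x \<in> I; y \<in> I\<rbrakk> \<Longrightarrow> x \<ominus> y \<in> I"
  by (simp add: a_minus_def)

lemma I_conj' [simp]: "\<lbrakk>x \<in> I; a \<in> carrier A\<rbrakk> \<Longrightarrow> a \<oplus> (x \<oplus> \<ominus> a) \<in> I"
  using I_conj by (simp add: gsimps)

lemma I_conj_neg [simp]: "\<lbrakk>x \<in> I; a \<in> carrier A\<rbrakk> \<Longrightarrow> \<ominus> a \<oplus> (x \<oplus> a) \<in> I"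
  using I_conj'[of x "\<ominus> a"] by simp

lemma subgroup_I: "subgroup I (add_monoid A)"
  by (rule subgroup.intro) (use I_neg in \<open>auto simp: a_inv_def\<close>)

lemma normal_I: "I \<lhd> add_monoid A"
  using subgroup_I I_conj
  by (intro group.normal_invI[OF add_group]) (auto simp: a_minus_def a_inv_def)

lemma coset_eq_iff:
  "\<lbrakk>a \<in> carrier A; b \<in> carrier A\<rbrakk> \<Longrightarrow> I +> a = I +> b \<longleftrightarrow> a \<ominus> b \<in> I"
  using group.rcos_self[OF add_group, of _ I] group.repr_independence[OF add_group _ _ subgroup_I]
    subgroup.rcos_module[OF subgroup_I add_group, of b a] subgroup_I
  by (auto simp: a_r_coset_def a_minus_def a_inv_def)

lemma in_coset_iff: "a \<in> carrier A \<Longrightarrow> y \<in> I +> a \<longleftrightarrow> (\<exists>x\<in>I. y = x \<oplus> a)"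
  by (auto simp: a_r_coset_def r_coset_def)

lemma coset_zero: "I +> \<zero> = I"
  by (auto simp: in_coset_iff)

lemma coset_eq_I_iff: "a \<in> carrier A \<Longrightarrow> I +> a = I \<longleftrightarrow> a \<in> I"
  using coset_eq_iff[of a \<zero>] by (simp add: coset_zero a_minus_def)

lemma coset_self: "a \<in> carrier A \<Longrightarrow> a \<in> I +> a"
  by (metis I_zero in_coset_iff zero_add)

text \<open>An additive translate \<open>x \<oplus> a\<close> is a multiplicative one: \<open>x \<oplus> a = a \<otimes> u\<close> with \<open>u\<close> in the ideal.\<close>

lemma mult_cong:
  assumes "x \<in> I" "y \<in> I" "a \<in> carrier A" "b \<in> carrier A"
  shows "\<exists>z\<in>I. (x \<oplus> a) \<otimes> (y \<oplus> b) = z \<oplus> (a \<otimes> b)"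
proof -
  define x' where "x' = \<ominus> a \<oplus> (x \<oplus> a)"
  define u where "u = inv a \<otimes> (a \<oplus> x')"
  define v where "v = (u \<otimes> (y \<oplus> b) \<ominus> (y \<oplus> b)) \<oplus> y"
  have x': "x' \<in> I" "x \<oplus> a = a \<oplus> x'" using assms by (simp_all add: x'_def)
  have "u = \<ominus> (inv a) \<oplus> inv a \<otimes> x'"
    using assms x' by (simp add: u_def brace)
  \<comment> \<open>The inner bracket lies in the ideal, so \<open>u\<close> is a conjugate of an
    ideal element.\<close>
  also have "\<dots> = \<ominus> (inv a) \<oplus> ((inv a \<otimes> x' \<ominus> inv a) \<oplus> inv a)"
    using assms x' by (simp add: gsimps)
  finally have u: "u \<in> I" using assms x' by simp
  have v: "v \<in> I" using u assms by (simp add: v_def)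
  have "(x \<oplus> a) \<otimes> (y \<oplus> b) = a \<otimes> (u \<otimes> (y \<oplus> b))"
    using assms x' u by (simp add: mult_assoc[symmetric] u_def)
  also have "u \<otimes> (y \<oplus> b) = v \<oplus> b" using assms u by (simp add: v_def gsimps)
  also have "a \<otimes> (v \<oplus> b) = (a \<otimes> v \<ominus> a) \<oplus> a \<otimes> b"
    using assms v by (simp add: mult_add_eq)
  finally show ?thesis using v assms by (intro bexI[of _ "a \<otimes> v \<ominus> a"]) simp_all
qed

lemma coset_add:
  assumes "a \<in> carrier A" "b \<in> carrier A"
  shows "(I +> a) <+> (I +> b) = I +> (a \<oplus> b)"
  using normal.rcos_sum[OF normal_I, of a b] assms by (simp add: a_r_coset_def set_add_def)

text \<open>\<open>rcoset_mult\<close> is a union over all pairs of representatives; by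
  \<open>mult_cong\<close> every member of the union is the same coset.\<close>

lemma coset_mult:
  assumes "a \<in> carrier A" "b \<in> carrier A"
  shows "rcoset_mult A I (I +> a) (I +> b) = I +> (a \<otimes> b)"
proof -
  have "I +> (a' \<otimes> b') = I +> (a \<otimes> b)" if ab: "a' \<in> I +> a" "b' \<in> I +> b" for a' b'
  proof -
    obtain x y where xy: "x \<in> I" "y \<in> I" "a' = x \<oplus> a" "b' = y \<oplus> b"
      using ab assms in_coset_iff by auto
    then obtain z where "z \<in> I" "a' \<otimes> b' = z \<oplus> (a \<otimes> b)"
      using mult_cong[of x y a b] assms by auto
    then show ?thesis using assms xy by (subst coset_eq_iff) (simp_all add: gsimps)
  qed
  then show ?thesis
    unfolding rcoset_mult_def using coset_self assms by blast
qed

lemma quot_simps: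
  "carrier (A Quot I) = (+>) I ` carrier A"
  "zero (A Quot I) = I +> \<zero>"
  "one (A Quot I) = I +> \<one>"
  "\<lbrakk>a \<in> carrier A; b \<in> carrier A\<rbrakk> \<Longrightarrow> (I +> a) \<oplus>\<^bsub>A Quot I\<^esub> (I +> b) = I +> (a \<oplus> b)"
  "\<lbrakk>a \<in> carrier A; b \<in> carrier A\<rbrakk> \<Longrightarrow> (I +> a) \<otimes>\<^bsub>A Quot I\<^esub> (I +> b) = I +> (a \<otimes> b)"
  unfolding FactRing_def A_RCOSETS_def RCOSETS_def a_r_coset_def[symmetric]
  using coset_add coset_mult coset_zero by auto

end

section \<open>Central quotients\<close>

context skb
begin

text \<open>Right translation by \<open>d\<close>, corrected so that zero is fixed.\<close>

definition rho :: "'a \<Rightarrow> 'a \<Rightarrow> 'a" where "rho d x = x \<otimes> d \<ominus> d"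

text \<open>The conjugate by \<open>d\<close> of the usual lambda map -d + d \<otimes> x. With the
  correction on the right, the image of a left summand splits off on the left, as in
  \<open>mult_add_lam\<close>.\<close>

definition lam :: "'a \<Rightarrow> 'a \<Rightarrow> 'a" where "lam d x = d \<otimes> x \<ominus> d"

lemma rho_closed [simp]: "\<lbrakk>x \<in> carrier A; d \<in> carrier A\<rbrakk> \<Longrightarrow> rho d x \<in> carrier A"
  and lam_closed [simp]: "\<lbrakk>x \<in> carrier A; d \<in> carrier A\<rbrakk> \<Longrightarrow> lam d x \<in> carrier A"
  by (simp_all add: rho_def lam_def)

lemma rho_add_eq: "\<lbrakk>x \<in> carrier A; d \<in> carrier A\<rbrakk> \<Longrightarrow> rho d x \<oplus> d = x \<otimes> d"
  and lam_add_eq: "\<lbrakk>x \<in> carrier A; d \<in> carrier A\<rbrakk> \<Longrightarrow> lam d x \<oplus> d = d \<otimes> x"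
  by (simp_all add: rho_def lam_def gsimps)

lemma mult_add_lam:
  "\<lbrakk>x \<in> carrier A; b \<in> carrier A; d \<in> carrier A\<rbrakk> \<Longrightarrow> d \<otimes> (x \<oplus> b) = lam d x \<oplus> d \<otimes> b"
  by (simp add: lam_def mult_add_eq)

lemma lam_add: "\<lbrakk>x \<in> carrier A; y \<in> carrier A; d \<in> carrier A\<rbrakk> \<Longrightarrow>
    lam d (x \<oplus> y) = lam d x \<oplus> lam d y"
  by (simp add: lam_def brace gsimps)

lemma lam_neg: "\<lbrakk>x \<in> carrier A; d \<in> carrier A\<rbrakk> \<Longrightarrow> lam d (\<ominus> x) = \<ominus> (lam d x)"
  by (simp add: lam_def mult_neg gsimps)

text \<open>Compute \<open>d \<otimes> (b \<otimes> x)\<close> in two ways: the maps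
  \<open>lam d\<close> form an action of the circle group.\<close>

lemma lam_lam: "\<lbrakk>x \<in> carrier A; b \<in> carrier A; d \<in> carrier A\<rbrakk> \<Longrightarrow>
    lam d (lam b x) = lam (d \<otimes> b) x"
  using mult_add_lam[of "lam b x" b d] by (simp add: lam_add_eq mult_assoc)
    (simp add: lam_def gsimps mult_assoc)

lemma lam_zero_left: "x \<in> carrier A \<Longrightarrow> lam \<zero> x = x"
  by (simp add: lam_def a_minus_def)

end

context skb_with_ideal
begin

lemma rho_I [simp]: "\<lbrakk>x \<in> I; d \<in> carrier A\<rbrakk> \<Longrightarrow> rho d x \<in> I"
  and lam_I [simp]: "\<lbrakk>x \<in> I; d \<in> carrier A\<rbrakk> \<Longrightarrow> lam d x \<in> I"
  by (simp_all add: rho_def lam_def)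

text \<open>Each distributor is rearranged into a sum of ideal elements and conjugates of ideal
  elements.\<close>

lemma distributor_I:
  assumes a: "a \<in> I" and b: "b \<in> carrier A" and c: "c \<in> carrier A"
  shows "right_distributor A a b c \<in> I" "right_distributor A b a c \<in> I"
    "right_distributor A b c a \<in> I"
proof -
  have sum: "\<exists>z\<in>I. (x \<oplus> b) \<otimes> c = z \<oplus> b \<otimes> c" if "x \<in> I" for x
    using mult_cong[of x \<zero> b c] that b c by simp
  obtain z where "z \<in> I" "(a \<oplus> b) \<otimes> c = z \<oplus> b \<otimes> c" using sum a by blast
  then have "right_distributor A a b c = z \<oplus> \<ominus> (rho c a)"
    using assms by (simp add: right_distributor_def rho_def gsimps)
  then show "right_distributor A a b c \<in> I" using assms \<open>z \<in> I\<close> by simp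
  obtain y where y: "y \<in> I" "((b \<oplus> (a \<oplus> \<ominus> b)) \<oplus> b) \<otimes> c = y \<oplus> b \<otimes> c"
    using sum[of "b \<oplus> (a \<oplus> \<ominus> b)"] assms by auto
  \<comment> \<open>The ideal summand is moved to the left of \<open>b\<close> at the price of a
    conjugation, so that \<open>sum\<close> applies.\<close>
  moreover have "(b \<oplus> (a \<oplus> \<ominus> b)) \<oplus> b = b \<oplus> a" using assms by (simp add: gsimps)
  ultimately have "right_distributor A b a c =
      y \<oplus> ((b \<otimes> c \<oplus> \<ominus> c) \<oplus> (\<ominus> (rho c a) \<oplus> \<ominus> (b \<otimes> c \<oplus> \<ominus> c)))"
    using assms by (simp add: right_distributor_def gsimps rho_add_eq[of a c, symmetric])
  also have "\<dots> \<in> I" using assms y by (intro I_add I_conj') simp_all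
  finally show "right_distributor A b a c \<in> I" .
  have "right_distributor A b c a =
      lam (b \<oplus> c) a \<oplus> ((b \<oplus> ((\<ominus> (lam c a) \<oplus> a) \<oplus> \<ominus> b)) \<oplus> \<ominus> (lam b a))"
    using assms by (simp add: right_distributor_def gsimps lam_add_eq[of a, symmetric])
  also have "\<dots> \<in> I" using assms by (intro I_add I_conj' I_neg) simp_all
  finally show "right_distributor A b c a \<in> I" .
qed

lemma commutator_I: "\<lbrakk>a \<in> I; b \<in> carrier A\<rbrakk> \<Longrightarrow> (a \<oplus> b \<ominus> a) \<ominus> b \<in> I"
  using I_add[of a "b \<oplus> (\<ominus> a \<oplus> \<ominus> b)"] I_conj'[of "\<ominus> a" b] by (simp add: gsimps)

end

text \<open>\<open>Q\<close> is a quotient of the additive group in which the ideal becomes central and distributivity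
  from the right holds as soon as one of the three arguments lies in the ideal.\<close>

locale central_quotient = skb_with_ideal +
  fixes Q :: "('q, 'm) monoid_scheme" and q :: "'a \<Rightarrow> 'q"
  assumes Q: "group Q"
    and q_closed [simp]: "a \<in> carrier A \<Longrightarrow> q a \<in> carrier Q"
    and q_add: "\<lbrakk>a \<in> carrier A; b \<in> carrier A\<rbrakk> \<Longrightarrow> q (a \<oplus> b) = q a \<otimes>\<^bsub>Q\<^esub> q b"
    and central: "\<lbrakk>x \<in> I; a \<in> carrier A\<rbrakk> \<Longrightarrow> q a \<otimes>\<^bsub>Q\<^esub> q x = q x \<otimes>\<^bsub>Q\<^esub> q a"
    and distrib: "\<lbrakk>a \<in> carrier A; b \<in> carrier A; d \<in> carrier A; a \<in> I \<or> b \<in> I \<or> d \<in> I\<rbrakk> \<Longrightarrow>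
      q ((a \<oplus> b) \<otimes> d) = q ((a \<otimes> d \<ominus> d) \<oplus> b \<otimes> d)"
begin

section \<open>Translations of ideal elements, seen in the central quotient\<close>

interpretation Q: group Q by (rule Q)

lemma q_zero: "q \<zero> = \<one>\<^bsub>Q\<^esub>"
  using q_add[of \<zero> \<zero>] by (simp add: Q.r_cancel_one')

lemma q_neg: "a \<in> carrier A \<Longrightarrow> q (\<ominus> a) = inv\<^bsub>Q\<^esub> q a"
  using q_add[of "\<ominus> a" a] by (simp add: q_zero Q.inv_equality)

lemma q_conj: "\<lbrakk>x \<in> I; b \<in> carrier A\<rbrakk> \<Longrightarrow> q (b \<oplus> (x \<oplus> \<ominus> b)) = q x"
  using central[of x "b \<oplus> \<ominus> b"] central[of x b]
  by (simp add: q_add q_neg Q.m_assoc[symmetric]) (simp add: Q.m_assoc)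

lemma q_add_mult:
  "\<lbrakk>x \<in> I; b \<in> carrier A; d \<in> carrier A\<rbrakk> \<Longrightarrow>
    q ((x \<oplus> b) \<otimes> d) = q (rho d x) \<otimes>\<^bsub>Q\<^esub> q (b \<otimes> d)"
  by (simp add: distrib rho_def q_add)

text \<open>The same value as with \<open>x\<close> on the left of \<open>b\<close>: the expansion
  differs only by a conjugation of \<open>rho d x\<close> and its position, and \<open>q\<close>
  sees neither because the ideal is central.\<close>

lemma q_add_mult':
  assumes "x \<in> I" "b \<in> carrier A" "d \<in> carrier A"
  shows "q ((b \<oplus> x) \<otimes> d) = q (rho d x) \<otimes>\<^bsub>Q\<^esub> q (b \<otimes> d)"
proof -
  have "q ((b \<oplus> x) \<otimes> d) = q ((b \<otimes> d \<ominus> d) \<oplus> x \<otimes> d)" using assms by (simp add: distrib)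
  also have "\<dots> = q (b \<otimes> d \<oplus> (\<ominus> d \<oplus> (rho d x \<oplus> d)))"
    using assms by (simp add: gsimps rho_add_eq)
  also have "\<dots> = q (rho d x) \<otimes>\<^bsub>Q\<^esub> q (b \<otimes> d)"
    using assms central[of "rho d x"] q_conj[of "rho d x" "\<ominus> d"] by (simp add: q_add)
  finally show ?thesis .
qed

text \<open>Expand \<open>(x \<oplus> y) \<otimes> d\<close> once as a whole and once with
  \<open>x\<close> split off. So \<open>rho d\<close>, followed by \<open>q\<close>, is additive on
  the ideal, as \<open>lam d\<close> is on all of \<open>A\<close>.\<close>

lemma q_rho_add:
  assumes "x \<in> I" "y \<in> I" "d \<in> carrier A"
  shows "q (rho d (x \<oplus> y)) = q (rho d x) \<otimes>\<^bsub>Q\<^esub> q (rho d y)"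
proof -
  have "q (rho d (x \<oplus> y)) \<otimes>\<^bsub>Q\<^esub> q d = (q (rho d x) \<otimes>\<^bsub>Q\<^esub> q (rho d y)) \<otimes>\<^bsub>Q\<^esub> q d"
    using assms q_add_mult[of x y d] by (simp add: q_add[symmetric] rho_add_eq)
      (simp add: q_add Q.m_assoc rho_add_eq[symmetric])
  then show ?thesis using assms by simp
qed

lemma q_rho_zero: "d \<in> carrier A \<Longrightarrow> q (rho d \<zero>) = \<one>\<^bsub>Q\<^esub>"
  by (simp add: rho_def a_minus_def q_zero)

lemma q_rho_neg:
  assumes "x \<in> I" "d \<in> carrier A"
  shows "q (rho d (\<ominus> x)) = inv\<^bsub>Q\<^esub> q (rho d x)"
  using assms q_rho_add[of "\<ominus> x" x d] by (simp add: q_rho_zero Q.inv_equality)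

text \<open>The conjugate followed by \<open>b\<close> is \<open>b \<oplus> x\<close>; compare the
  two expansions of \<open>(b \<oplus> x) \<otimes> d\<close>.\<close>

lemma q_rho_conj:
  assumes "x \<in> I" "b \<in> carrier A" "d \<in> carrier A"
  shows "q (rho d (b \<oplus> (x \<oplus> \<ominus> b))) = q (rho d x)"
proof -
  have "(b \<oplus> (x \<oplus> \<ominus> b)) \<oplus> b = b \<oplus> x" using assms by (simp add: gsimps)
  then have "q (rho d (b \<oplus> (x \<oplus> \<ominus> b))) \<otimes>\<^bsub>Q\<^esub> q (b \<otimes> d) = q (rho d x) \<otimes>\<^bsub>Q\<^esub> q (b \<otimes> d)"
    using assms q_add_mult[of "b \<oplus> (x \<oplus> \<ominus> b)" b d] q_add_mult'[of x b d] by simp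
  then show ?thesis using assms by simp
qed

text \<open>Associativity of \<open>x \<otimes> c \<otimes> d\<close>, with
  \<open>x \<otimes> c\<close> written as \<open>rho c x \<oplus> c\<close>.\<close>

lemma q_rho_rho:
  assumes "x \<in> I" "c \<in> carrier A" "d \<in> carrier A"
  shows "q (rho d (rho c x)) = q (rho (c \<otimes> d) x)"
proof -
  have "q (rho d (rho c x)) \<otimes>\<^bsub>Q\<^esub> q (c \<otimes> d) = q (rho (c \<otimes> d) x) \<otimes>\<^bsub>Q\<^esub> q (c \<otimes> d)"
    using assms q_add_mult[of "rho c x" c d]
    by (simp add: rho_add_eq mult_assoc q_add[symmetric])
  then show ?thesis using assms by simp
qed

text \<open>Associativity of \<open>d \<otimes> x \<otimes> c\<close>: left and right translations
  commute under \<open>q\<close>.\<close>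

lemma q_lam_rho:
  assumes "x \<in> I" "c \<in> carrier A" "d \<in> carrier A"
  shows "q (rho c (lam d x)) = q (lam d (rho c x))"
proof -
  have "q (rho c (lam d x)) \<otimes>\<^bsub>Q\<^esub> q (d \<otimes> c) = q ((lam d x \<oplus> d) \<otimes> c)"
    using assms by (simp add: q_add_mult)
  also have "\<dots> = q (d \<otimes> (rho c x \<oplus> c))" using assms by (simp add: lam_add_eq rho_add_eq mult_assoc)
  also have "\<dots> = q (lam d (rho c x)) \<otimes>\<^bsub>Q\<^esub> q (d \<otimes> c)"
    using assms by (simp add: mult_add_lam q_add)
  finally show ?thesis using assms by simp
qed

text \<open>This is right distributivity with the third argument in the ideal; the conjugation by
  \<open>b\<close> that appears on the way is removed by \<open>q_conj\<close>.\<close>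

lemma q_lam_sum:
  assumes "x \<in> I" "b \<in> carrier A" "c \<in> carrier A"
  shows "q (lam (b \<oplus> c) x) = q (lam b x) \<otimes>\<^bsub>Q\<^esub> (inv\<^bsub>Q\<^esub> q x \<otimes>\<^bsub>Q\<^esub> q (lam c x))"
proof -
  have "q (lam (b \<oplus> c) x) \<otimes>\<^bsub>Q\<^esub> q (b \<oplus> c) = q ((b \<otimes> x \<ominus> x) \<oplus> c \<otimes> x)"
    using assms by (simp add: q_add[symmetric] lam_add_eq distrib)
  also have "\<dots> = q (lam b x \<oplus> ((b \<oplus> ((\<ominus> x \<oplus> lam c x) \<oplus> \<ominus> b)) \<oplus> (b \<oplus> c)))"
    using assms by (simp add: lam_add_eq[symmetric] gsimps)
  also have "\<dots> = q (lam b x) \<otimes>\<^bsub>Q\<^esub> (q (\<ominus> x \<oplus> lam c x) \<otimes>\<^bsub>Q\<^esub> q (b \<oplus> c))"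
    using assms q_conj[of "\<ominus> x \<oplus> lam c x" b]
    by (simp only: q_add I_neg I_add lam_I I_carrier add_closed neg_closed)
  also have "\<dots> = (q (lam b x) \<otimes>\<^bsub>Q\<^esub> (inv\<^bsub>Q\<^esub> q x \<otimes>\<^bsub>Q\<^esub> q (lam c x))) \<otimes>\<^bsub>Q\<^esub> q (b \<oplus> c)"
    using assms by (simp add: q_add q_neg Q.m_assoc)
  finally show ?thesis using assms by simp
qed

text \<open>When \<open>q\<close> is the projection modulo the commutator of \<open>I\<close>, this
  says that both translates of \<open>g\<close> lie in the commutator, which is what the ideal
  property requires of the generators.\<close>

definition killed :: "'a \<Rightarrow> bool" where
  "killed g \<longleftrightarrow> g \<in> I \<and> (\<forall>d\<in>carrier A. q (rho d g) = \<one>\<^bsub>Q\<^esub> \<and> q (lam d g) = \<one>\<^bsub>Q\<^esub>)"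

lemma cancel_inv: "\<lbrakk>x \<in> carrier Q; y \<in> carrier Q\<rbrakk> \<Longrightarrow> x \<otimes>\<^bsub>Q\<^esub> (inv\<^bsub>Q\<^esub> x \<otimes>\<^bsub>Q\<^esub> y) = y"
  and cancel_inv': "\<lbrakk>x \<in> carrier Q; y \<in> carrier Q\<rbrakk> \<Longrightarrow> inv\<^bsub>Q\<^esub> x \<otimes>\<^bsub>Q\<^esub> (x \<otimes>\<^bsub>Q\<^esub> y) = y"
  by (simp_all add: Q.m_assoc[symmetric])

lemma cancel_one: "\<lbrakk>x \<otimes>\<^bsub>Q\<^esub> y = y; x \<in> carrier Q; y \<in> carrier Q\<rbrakk> \<Longrightarrow> x = \<one>\<^bsub>Q\<^esub>"
  by (simp add: Q.r_cancel_one')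

text \<open>Expand \<open>(a \<oplus> b) \<otimes> c \<otimes> d\<close> and
  \<open>d \<otimes> (a \<oplus> b) \<otimes> c\<close> twice: by first splitting off the
  distributor, and by associativity. The other factors agree, so the factor coming from the
  distributor is trivial.\<close>

lemma killed_distributor1:
  assumes a: "a \<in> I" and b: "b \<in> carrier A" and c: "c \<in> carrier A"
  shows "killed (right_distributor A a b c)"
  unfolding killed_def
proof (intro conjI ballI)
  let ?g = "right_distributor A a b c"
  show g: "?g \<in> I" using assms by (rule distributor_I)
  fix d assume d: "d \<in> carrier A"
  have eq: "(a \<oplus> b) \<otimes> c = ?g \<oplus> (rho c a \<oplus> b \<otimes> c)"
    using assms by (simp add: add_mult_eq rho_def)
  have "q (rho d ?g) \<otimes>\<^bsub>Q\<^esub> (q (rho d (rho c a)) \<otimes>\<^bsub>Q\<^esub> q (b \<otimes> c \<otimes> d)) = q ((a \<oplus> b) \<otimes> c \<otimes> d)"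
    unfolding eq using assms d g by (simp add: q_add_mult)
  also have "\<dots> = q (rho d (rho c a)) \<otimes>\<^bsub>Q\<^esub> q (b \<otimes> c \<otimes> d)"
    using assms d by (simp add: mult_assoc q_add_mult q_rho_rho)
  finally show "q (rho d ?g) = \<one>\<^bsub>Q\<^esub>"
    by (rule cancel_one) (use assms d g in \<open>simp_all\<close>)
  have "q (lam d ?g) \<otimes>\<^bsub>Q\<^esub> (q (lam d (rho c a)) \<otimes>\<^bsub>Q\<^esub> q (d \<otimes> b \<otimes> c)) = q (d \<otimes> ((a \<oplus> b) \<otimes> c))"
    unfolding eq using assms d g by (simp add: mult_add_lam q_add mult_assoc)
  also have "\<dots> = q ((lam d a \<oplus> d \<otimes> b) \<otimes> c)"
    using assms d by (simp add: mult_assoc[symmetric] mult_add_lam)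
  also have "\<dots> = q (lam d (rho c a)) \<otimes>\<^bsub>Q\<^esub> q (d \<otimes> b \<otimes> c)"
    using assms d by (simp add: q_add_mult q_lam_rho)
  finally show "q (lam d ?g) = \<one>\<^bsub>Q\<^esub>"
    by (rule cancel_one) (use assms d g in \<open>simp_all\<close>)
qed

text \<open>The comparison is that of \<open>killed_distributor1\<close>; the ideal element now
  stands on the right, which adds conjugations by \<open>c\<close> and \<open>d\<close> that
  \<open>q\<close> does not see.\<close>

lemma killed_distributor2:
  assumes a: "a \<in> I" and b: "b \<in> carrier A" and c: "c \<in> carrier A"
  shows "killed (right_distributor A b a c)"
  unfolding killed_def
proof (intro conjI ballI)
  let ?g = "right_distributor A b a c"
  show g: "?g \<in> I" using assms by (rule distributor_I)
  fix d assume d: "d \<in> carrier A"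
  have "(b \<oplus> a) \<otimes> c = ?g \<oplus> ((b \<otimes> c \<ominus> c) \<oplus> (rho c a \<oplus> c))"
    using assms by (simp add: add_mult_eq rho_add_eq)
  also have "\<dots> = ?g \<oplus> (b \<otimes> c \<oplus> (\<ominus> c \<oplus> (rho c a \<oplus> c)))"
    using assms by (simp add: gsimps)
  finally have eq: "(b \<oplus> a) \<otimes> c = ?g \<oplus> (b \<otimes> c \<oplus> (\<ominus> c \<oplus> (rho c a \<oplus> c)))" .
  have "q (rho d ?g) \<otimes>\<^bsub>Q\<^esub> (q (rho d (rho c a)) \<otimes>\<^bsub>Q\<^esub> q (b \<otimes> c \<otimes> d)) = q ((b \<oplus> a) \<otimes> c \<otimes> d)"
    unfolding eq using assms d g q_rho_conj[of "rho c a" "\<ominus> c" d]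
    by (simp add: q_add_mult q_add_mult')
  also have "\<dots> = q (rho d (rho c a)) \<otimes>\<^bsub>Q\<^esub> q (b \<otimes> c \<otimes> d)"
    using assms d by (simp add: mult_assoc q_add_mult' q_rho_rho)
  finally show "q (rho d ?g) = \<one>\<^bsub>Q\<^esub>"
    by (rule cancel_one) (use assms d g in \<open>simp_all\<close>)
  \<comment> \<open>The counterpart of \<open>mult_add_lam\<close> for a right summand, which comes
    out conjugated by \<open>d\<close>.\<close>
  have lam_right: "d \<otimes> (u \<oplus> x) = (d \<otimes> u) \<oplus> (\<ominus> d \<oplus> (lam d x \<oplus> d))"
    if "x \<in> I" "u \<in> carrier A" for u x
    using that d by (simp add: brace lam_add_eq)
  define w where "w = \<ominus> c \<oplus> (rho c a \<oplus> c)"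
  have w: "w \<in> I" using assms by (simp add: w_def)
  \<comment> \<open>As \<open>lam d\<close> is additive, it turns the conjugate \<open>w\<close> of
    \<open>rho c a\<close> into a conjugate of \<open>lam d (rho c a)\<close>.\<close>
  have "lam d w = \<ominus> (lam d c) \<oplus> (lam d (rho c a) \<oplus> lam d c)"
    using assms d by (simp add: w_def lam_add lam_neg)
  then have 1: "q (lam d w) = q (lam d (rho c a))"
    using q_conj[of "lam d (rho c a)" "\<ominus> (lam d c)"] assms d by simp
  have "q (d \<otimes> ((b \<oplus> a) \<otimes> c)) =
      q (lam d ?g) \<otimes>\<^bsub>Q\<^esub> (q (d \<otimes> b \<otimes> c) \<otimes>\<^bsub>Q\<^esub> q (\<ominus> d \<oplus> (lam d w \<oplus> d)))"
    unfolding eq w_def[symmetric] using assms d g w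
    by (simp only: mult_add_lam[of ?g] lam_right q_add mult_assoc I_carrier add_closed mult_closed
        neg_closed lam_closed)
  then have "q (lam d ?g) \<otimes>\<^bsub>Q\<^esub> (q (lam d (rho c a)) \<otimes>\<^bsub>Q\<^esub> q (d \<otimes> b \<otimes> c)) = q (d \<otimes> ((b \<oplus> a) \<otimes> c))"
    using assms d w 1 q_conj[of "lam d w" "\<ominus> d"] central[of "lam d (rho c a)" "d \<otimes> b \<otimes> c"] by simp
  also have "\<dots> = q ((d \<otimes> b \<oplus> (\<ominus> d \<oplus> (lam d a \<oplus> d))) \<otimes> c)"
    using assms d by (simp add: mult_assoc[symmetric] lam_right)
  also have "\<dots> = q (lam d (rho c a)) \<otimes>\<^bsub>Q\<^esub> q (d \<otimes> b \<otimes> c)"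
    using assms d q_rho_conj[of "lam d a" "\<ominus> d" c] by (simp add: q_add_mult' q_lam_rho)
  finally show "q (lam d ?g) = \<one>\<^bsub>Q\<^esub>"
    by (rule cancel_one) (use assms d g in \<open>simp_all\<close>)
qed

text \<open>The commutator \<open>g\<close> satisfies
  \<open>a \<oplus> b = g \<oplus> (b \<oplus> a)\<close>. After either translation \<open>q\<close>
  gives \<open>a \<oplus> b\<close> and \<open>b \<oplus> a\<close> the same value, so the
  contribution of \<open>g\<close> is trivial.\<close>

lemma killed_commutator:
  assumes a: "a \<in> I" and b: "b \<in> carrier A"
  shows "killed ((a \<oplus> b \<ominus> a) \<ominus> b)"
  unfolding killed_def
proof (intro conjI ballI)
  let ?g = "(a \<oplus> b \<ominus> a) \<ominus> b"
  show g: "?g \<in> I" using assms by (rule commutator_I)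
  fix d assume d: "d \<in> carrier A"
  have eq: "a \<oplus> b = ?g \<oplus> (b \<oplus> a)" using assms by (simp add: gsimps)
  have "q (rho d ?g) \<otimes>\<^bsub>Q\<^esub> (q (rho d a) \<otimes>\<^bsub>Q\<^esub> q (b \<otimes> d)) = q ((a \<oplus> b) \<otimes> d)"
    by (subst eq) (use assms d g in \<open>simp add: q_add_mult q_add_mult'\<close>)
  also have "\<dots> = q (rho d a) \<otimes>\<^bsub>Q\<^esub> q (b \<otimes> d)" using assms d by (simp add: q_add_mult)
  finally show "q (rho d ?g) = \<one>\<^bsub>Q\<^esub>"
    by (rule cancel_one) (use assms d g in \<open>simp_all\<close>)
  have "q (lam d (a \<oplus> b)) = q (lam d ?g) \<otimes>\<^bsub>Q\<^esub> (q (lam d b) \<otimes>\<^bsub>Q\<^esub> q (lam d a))"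
    by (subst eq) (use assms d g in \<open>simp add: lam_add q_add\<close>)
  moreover have "q (lam d (a \<oplus> b)) = q (lam d b) \<otimes>\<^bsub>Q\<^esub> q (lam d a)"
    using assms d central[of "lam d a" "lam d b"] by (simp add: lam_add q_add)
  ultimately have "q (lam d ?g) \<otimes>\<^bsub>Q\<^esub> (q (lam d b) \<otimes>\<^bsub>Q\<^esub> q (lam d a)) = q (lam d b) \<otimes>\<^bsub>Q\<^esub> q (lam d a)"
    by simp
  then show "q (lam d ?g) = \<one>\<^bsub>Q\<^esub>"
    by (rule cancel_one) (use assms d g in \<open>simp_all\<close>)
qed

text \<open>Here the distributor measures how \<open>lam (b \<oplus> c) a\<close> deviates from the
  formula of \<open>q_lam_sum\<close>. Translating both sides by \<open>d\<close> and applying that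
  formula again shows that the translated deviation vanishes under \<open>q\<close>.\<close>

lemma killed_distributor3:
  assumes a: "a \<in> I" and b: "b \<in> carrier A" and c: "c \<in> carrier A"
  shows "killed (right_distributor A b c a)"
  unfolding killed_def
proof (intro conjI ballI)
  let ?g = "right_distributor A b c a"
  show g: "?g \<in> I" using assms by (rule distributor_I)
  fix d assume d: "d \<in> carrier A"
  define y where "y = \<ominus> a \<oplus> lam c a"
  have y: "y \<in> I" using assms by (simp add: y_def)
  have "lam (b \<oplus> c) a \<oplus> (b \<oplus> c) = ?g \<oplus> ((b \<otimes> a \<ominus> a) \<oplus> c \<otimes> a)"
    using assms by (simp add: lam_add_eq add_mult_eq)
  also have "\<dots> = (?g \<oplus> (lam b a \<oplus> (b \<oplus> (y \<oplus> \<ominus> b)))) \<oplus> (b \<oplus> c)"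
    using assms by (simp add: lam_add_eq[symmetric] gsimps y_def)
  finally have eq: "lam (b \<oplus> c) a = ?g \<oplus> (lam b a \<oplus> (b \<oplus> (y \<oplus> \<ominus> b)))"
    using assms y g by (subst (asm) add_right_cancel) simp_all
  have "q (rho d ?g) \<otimes>\<^bsub>Q\<^esub> (q (rho d (lam b a)) \<otimes>\<^bsub>Q\<^esub> q (rho d y)) = q (rho d (lam (b \<oplus> c) a))"
    unfolding eq using assms y d g q_rho_conj[of y b d] by (simp add: q_rho_add)
  also have "\<dots> = q (rho d (lam b a)) \<otimes>\<^bsub>Q\<^esub> q (rho d y)"
    using assms d by (simp add: y_def q_rho_add q_rho_neg q_lam_rho q_lam_sum)
  finally show "q (rho d ?g) = \<one>\<^bsub>Q\<^esub>"
    by (rule cancel_one) (use assms d g y in \<open>simp_all\<close>)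
  \<comment> \<open>Obtained from \<open>q_lam_sum\<close> for the sum
    \<open>\<ominus> d \<oplus> d\<close>, since \<open>lam \<zero>\<close> is the identity.\<close>
  have neg: "q (lam (\<ominus> d) a) = q a \<otimes>\<^bsub>Q\<^esub> (inv\<^bsub>Q\<^esub> q (lam d a) \<otimes>\<^bsub>Q\<^esub> q a)"
  proof -
    have "q a = q (lam (\<ominus> d) a) \<otimes>\<^bsub>Q\<^esub> (inv\<^bsub>Q\<^esub> q a \<otimes>\<^bsub>Q\<^esub> q (lam d a))"
      using assms d q_lam_sum[of a "\<ominus> d" d] by (simp add: lam_zero_left)
    then have "q a \<otimes>\<^bsub>Q\<^esub> (inv\<^bsub>Q\<^esub> q (lam d a) \<otimes>\<^bsub>Q\<^esub> q a) =
        (q (lam (\<ominus> d) a) \<otimes>\<^bsub>Q\<^esub> (inv\<^bsub>Q\<^esub> q a \<otimes>\<^bsub>Q\<^esub> q (lam d a))) \<otimes>\<^bsub>Q\<^esub> (inv\<^bsub>Q\<^esub> q (lam d a) \<otimes>\<^bsub>Q\<^esub> q a)"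
      by (rule arg_cong[where f = "\<lambda>u. u \<otimes>\<^bsub>Q\<^esub> (inv\<^bsub>Q\<^esub> q (lam d a) \<otimes>\<^bsub>Q\<^esub> q a)"])
    then show ?thesis using assms d by (simp add: Q.m_assoc cancel_inv cancel_inv')
  qed
  have "lam d (b \<oplus> (y \<oplus> \<ominus> b)) = lam d b \<oplus> (lam d y \<oplus> \<ominus> (lam d b))"
    using assms y d by (simp add: lam_add lam_neg)
  then have "q (lam d ?g) \<otimes>\<^bsub>Q\<^esub> (q (lam d (lam b a)) \<otimes>\<^bsub>Q\<^esub> q (lam d y)) = q (lam d (lam (b \<oplus> c) a))"
    unfolding eq using assms y d g q_conj[of "lam d y" "lam d b"]
    by (simp add: lam_add[of ?g] lam_add[of "lam b a"] q_add)
  \<comment> \<open>The two left translations compose to one by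
    \<open>d \<otimes> (b \<oplus> c)\<close>, which the brace identity breaks into three summands;
    \<open>q_lam_sum\<close> and \<open>neg\<close> then treat these separately.\<close>
  also have "\<dots> = q (lam ((d \<otimes> b \<oplus> \<ominus> d) \<oplus> d \<otimes> c) a)"
    using assms d by (simp add: lam_lam brace add_assoc)
  also have "\<dots> = q (lam d (lam b a)) \<otimes>\<^bsub>Q\<^esub> q (lam d y)"
    using assms d by (simp add: q_lam_sum neg y_def lam_add lam_neg lam_lam q_add q_neg Q.m_assoc
        cancel_inv cancel_inv')
  finally show "q (lam d ?g) = \<one>\<^bsub>Q\<^esub>"
    by (rule cancel_one) (use assms d g y in \<open>simp_all\<close>)
qed

end

section \<open>The commutator of an ideal\<close>

context central_quotient
begin

interpretation Q: group Q by (rule Q)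

lemma q_conj_left: "\<lbrakk>x \<in> I; u \<in> carrier A\<rbrakk> \<Longrightarrow> q (x \<oplus> (u \<oplus> \<ominus> x)) = q u"
  using central[of x "u \<oplus> \<ominus> x"] by (simp add: q_add[symmetric] gsimps)

text \<open>The shift puts \<open>rho c x\<close> in front of two terms that occur with opposite
  signs, so the distributor is merely conjugated by an ideal element.\<close>

lemma q_distributor1:
  assumes "x \<in> I" "a \<in> carrier A" "b \<in> carrier A" "c \<in> carrier A"
  shows "q (right_distributor A (x \<oplus> a) b c) = q (right_distributor A a b c)"
proof -
  have "q ((x \<oplus> a \<oplus> b) \<otimes> c) = q (rho c x) \<otimes>\<^bsub>Q\<^esub> q ((a \<oplus> b) \<otimes> c)"
    "q ((x \<oplus> a) \<otimes> c) = q (rho c x) \<otimes>\<^bsub>Q\<^esub> q (a \<otimes> c)"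
    using assms by (simp_all add: q_add_mult add_assoc)
  then have "q (right_distributor A (x \<oplus> a) b c) =
      q (rho c x \<oplus> (right_distributor A a b c \<oplus> \<ominus> (rho c x)))"
    using assms by (simp add: right_distributor_def a_minus_def q_add q_neg Q.m_assoc
        Q.inv_mult_group)
  then show ?thesis using assms by (simp add: q_conj_left)
qed

text \<open>Here only the part \<open>(a \<oplus> b) \<otimes> c \<ominus> b \<otimes> c\<close> of
  the distributor is conjugated, again by \<open>rho c x\<close>.\<close>

lemma q_distributor2:
  assumes "x \<in> I" "a \<in> carrier A" "b \<in> carrier A" "c \<in> carrier A"
  shows "q (right_distributor A a (x \<oplus> b) c) = q (right_distributor A a b c)"
proof -
  have "a \<oplus> (x \<oplus> b) = (a \<oplus> (x \<oplus> \<ominus> a)) \<oplus> (a \<oplus> b)" using assms by (simp add: gsimps)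
  then have "q ((a \<oplus> (x \<oplus> b)) \<otimes> c) = q (rho c x) \<otimes>\<^bsub>Q\<^esub> q ((a \<oplus> b) \<otimes> c)"
    using assms by (simp add: q_add_mult q_rho_conj)
  moreover have "q ((x \<oplus> b) \<otimes> c) = q (rho c x) \<otimes>\<^bsub>Q\<^esub> q (b \<otimes> c)"
    using assms by (simp add: q_add_mult)
  ultimately have "q (right_distributor A a (x \<oplus> b) c) =
      q (rho c x \<oplus> (((a \<oplus> b) \<otimes> c \<ominus> b \<otimes> c) \<oplus> \<ominus> (rho c x))) \<otimes>\<^bsub>Q\<^esub> q (c \<ominus> a \<otimes> c)"
    using assms by (simp add: right_distributor_def a_minus_def q_add q_neg Q.m_assoc
        Q.inv_mult_group)
  also have "\<dots> = q (right_distributor A a b c)"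
    using assms q_conj_left[of "rho c x" "(a \<oplus> b) \<otimes> c \<ominus> b \<otimes> c"]
    by (simp add: right_distributor_def q_add[symmetric] gsimps)
  finally show ?thesis .
qed

text \<open>The shift enters all four terms. After \<open>q_lam_sum\<close> splits
  \<open>lam (a \<oplus> b) x\<close>, the result is a nest of conjugations by
  \<open>lam b x\<close> (giving \<open>u\<close>), \<open>\<ominus> x\<close> (giving
  \<open>v\<close>) and \<open>lam a x\<close>, peeled off from the outside.\<close>

lemma q_distributor3:
  assumes "x \<in> I" "a \<in> carrier A" "b \<in> carrier A" "c \<in> carrier A"
  shows "q (right_distributor A a b (x \<oplus> c)) = q (right_distributor A a b c)"
proof -
  define u where "u = lam b x \<oplus> (((a \<oplus> b) \<otimes> c \<ominus> b \<otimes> c) \<oplus> \<ominus> (lam b x))"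
  define v where "v = \<ominus> x \<oplus> (u \<oplus> \<ominus> (\<ominus> x))"
  have uv: "u \<in> carrier A" "v \<in> carrier A" using assms by (simp_all add: u_def v_def)
  have "q (right_distributor A a b (x \<oplus> c)) =
      q (lam a x \<oplus> ((v \<oplus> (c \<ominus> a \<otimes> c)) \<oplus> \<ominus> (lam a x)))"
    using assms by (simp add: right_distributor_def mult_add_lam u_def v_def a_minus_def q_add q_neg
        q_lam_sum Q.m_assoc Q.inv_mult_group)
  also have "\<dots> = q v \<otimes>\<^bsub>Q\<^esub> q (c \<ominus> a \<otimes> c)"
    using assms uv by (subst q_conj_left) (simp_all add: q_add)
  also have "q v = q u" unfolding v_def using assms uv by (subst q_conj_left) simp_all
  also have "q u = q ((a \<oplus> b) \<otimes> c \<ominus> b \<otimes> c)"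
    unfolding u_def using assms by (subst q_conj_left) simp_all
  also have "q ((a \<oplus> b) \<otimes> c \<ominus> b \<otimes> c) \<otimes>\<^bsub>Q\<^esub> q (c \<ominus> a \<otimes> c) = q (right_distributor A a b c)"
    using assms by (simp add: right_distributor_def q_add[symmetric] gsimps)
  finally show ?thesis .
qed

lemma q_distributor_cong:
  assumes "x \<in> I" "y \<in> I" "z \<in> I" "a \<in> carrier A" "b \<in> carrier A" "c \<in> carrier A"
  shows "q (right_distributor A (x \<oplus> a) (y \<oplus> b) (z \<oplus> c)) = q (right_distributor A a b c)"
  using assms by (simp add: q_distributor1 q_distributor2 q_distributor3)

lemma q_commutator_cong:
  assumes "x \<in> I" "y \<in> I" "a \<in> carrier A" "b \<in> carrier A"
  shows "q ((x \<oplus> a) \<oplus> (y \<oplus> b) \<ominus> (x \<oplus> a) \<ominus> (y \<oplus> b)) = q (a \<oplus> b \<ominus> a \<ominus> b)"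
proof -
  have "q ((x \<oplus> a) \<oplus> (y \<oplus> b) \<ominus> (x \<oplus> a) \<ominus> (y \<oplus> b)) =
      q (x \<oplus> ((a \<oplus> (y \<oplus> b) \<ominus> a) \<oplus> \<ominus> x)) \<otimes>\<^bsub>Q\<^esub> q (\<ominus> (y \<oplus> b))"
    using assms by (simp add: q_add[symmetric] gsimps)
  also have "\<dots> = q a \<otimes>\<^bsub>Q\<^esub> q (y \<oplus> ((b \<ominus> a \<ominus> b) \<oplus> \<ominus> y))"
    using assms by (subst q_conj_left) (simp_all add: q_add[symmetric] gsimps)
  also have "\<dots> = q (a \<oplus> b \<ominus> a \<ominus> b)"
    using assms by (subst q_conj_left) (simp_all add: q_add[symmetric] gsimps)
  finally show ?thesis .
qed

end

section \<open>Generation and induction for the commutator, and its ideal property\<close>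

lemma (in skb) radrng_commutator_gens:
  assumes "I \<subseteq> carrier A"
  shows "(\<Union>a\<in>I. \<Union>b\<in>carrier A. \<Union>c\<in>carrier A.
        {right_distributor A a b c, right_distributor A c a b, right_distributor A b c a,
         (a \<oplus> b \<ominus> a) \<ominus> b}) \<subseteq> carrier (add_monoid A)"
proof -
  have "a \<in> carrier A" if "a \<in> I" for a using assms that by blast
  then show ?thesis by auto
qed

lemma (in skb) subgroup_radrng_commutator:
  "I \<subseteq> carrier A \<Longrightarrow> subgroup (radrng_commutator A I) (add_monoid A)"
  unfolding radrng_commutator_def
  by (rule group.generate_is_subgroup[OF add_group radrng_commutator_gens])

lemma (in skb) radrng_commutator_closed:
  assumes "I \<subseteq> carrier A"
  shows "x \<in> radrng_commutator A I \<Longrightarrow> x \<in> carrier A"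
    "\<zero> \<in> radrng_commutator A I"
    "x \<in> radrng_commutator A I \<Longrightarrow> \<ominus> x \<in> radrng_commutator A I"
    "\<lbrakk>x \<in> radrng_commutator A I; y \<in> radrng_commutator A I\<rbrakk> \<Longrightarrow> x \<oplus> y \<in> radrng_commutator A I"
  using subgroup_radrng_commutator[OF assms]
  by (auto simp: subgroup_def a_inv_def)

lemma radrng_commutator_generators:
  assumes "a \<in> I" "b \<in> carrier A" "c \<in> carrier A"
  shows "right_distributor A a b c \<in> radrng_commutator A I"
    "right_distributor A b a c \<in> radrng_commutator A I"
    "right_distributor A b c a \<in> radrng_commutator A I"
  unfolding radrng_commutator_def by (rule generate.incl, use assms in blast)+

lemma radrng_commutator_commutator:
  assumes "a \<in> I" "b \<in> carrier A"
  shows "(a \<oplus>\<^bsub>A\<^esub> b \<ominus>\<^bsub>A\<^esub> a) \<ominus>\<^bsub>A\<^esub> b \<in> radrng_commutator A I"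
  unfolding radrng_commutator_def by (rule generate.incl) (use assms in blast)

text \<open>Induction over \<open>generate\<close> with membership in the carrier added to the
  invariant; the case of an inverted generator is absorbed by closure of \<open>P\<close> under
  negation.\<close>

lemma (in skb) radrng_commutator_induct [consumes 2, case_names
    zero distributor1 distributor2 distributor3 commutator neg add]:
  assumes "x \<in> radrng_commutator A I" "I \<subseteq> carrier A"
    and "P \<zero>"
    and "\<And>a b c. \<lbrakk>a \<in> I; b \<in> carrier A; c \<in> carrier A\<rbrakk> \<Longrightarrow> P (right_distributor A a b c)"
    and "\<And>a b c. \<lbrakk>a \<in> I; b \<in> carrier A; c \<in> carrier A\<rbrakk> \<Longrightarrow> P (right_distributor A b a c)"
    and "\<And>a b c. \<lbrakk>a \<in> I; b \<in> carrier A; c \<in> carrier A\<rbrakk> \<Longrightarrow> P (right_distributor A b c a)"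
    and "\<And>a b. \<lbrakk>a \<in> I; b \<in> carrier A\<rbrakk> \<Longrightarrow> P ((a \<oplus> b \<ominus> a) \<ominus> b)"
    and neg: "\<And>x. \<lbrakk>x \<in> carrier A; P x\<rbrakk> \<Longrightarrow> P (\<ominus> x)"
    and add: "\<And>x y. \<lbrakk>x \<in> carrier A; y \<in> carrier A; P x; P y\<rbrakk> \<Longrightarrow> P (x \<oplus> y)"
  shows "P x"
proof -
  let ?S = "\<Union>a\<in>I. \<Union>b\<in>carrier A. \<Union>c\<in>carrier A.
        {right_distributor A a b c, right_distributor A c a b, right_distributor A b c a,
         (a \<oplus> b \<ominus> a) \<ominus> b}"
  have S: "y \<in> carrier A \<and> P y" if "y \<in> ?S" for y
    using that assms(2) radrng_commutator_gens[OF assms(2)] assms(4-7) by auto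
  from assms(1)[unfolded radrng_commutator_def] have "x \<in> carrier A \<and> P x"
  proof (induction rule: generate.induct)
    case one
    then show ?case using \<open>P \<zero>\<close> by simp
  next
    case (incl h)
    then show ?case by (rule S)
  next
    case (inv h)
    then show ?case using S[OF inv] neg[of h] neg_closed[of h] unfolding a_inv_def by simp
  next
    case (eng h1 h2)
    then show ?case using add by simp
  qed
  then show ?thesis ..
qed

lemma (in skb) radrng_commutator_mono:
  "I \<subseteq> J \<Longrightarrow> radrng_commutator A I \<subseteq> radrng_commutator A J"
  unfolding radrng_commutator_def
  by (rule group.mono_generate[OF add_group]) blast

context skb_with_ideal
begin

lemma I_subset: "I \<subseteq> carrier A" by auto

lemma radrng_commutator_subset:
  assumes "x \<in> radrng_commutator A I"
  shows "x \<in> I"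
  using assms I_subset
  by (induction rule: radrng_commutator_induct) (auto simp: distributor_I commutator_I)

lemma radrng_commutator_conj:
  assumes x: "x \<in> radrng_commutator A I" and a: "a \<in> carrier A"
  shows "(a \<oplus> x) \<ominus> a \<in> radrng_commutator A I"
proof -
  have xI: "x \<in> I" using x by (rule radrng_commutator_subset)
  \<comment> \<open>The conjugate of \<open>x\<close> by \<open>a\<close> equals \<open>x\<close>
    plus the commutator of \<open>\<ominus> x\<close> and \<open>a\<close>; the latter is a
    generator because \<open>x\<close> lies in \<open>I\<close>.\<close>
  have "x \<oplus> ((\<ominus> x \<oplus> a \<ominus> \<ominus> x) \<ominus> a) \<in> radrng_commutator A I"
    using radrng_commutator_closed[OF I_subset] x xI a
      radrng_commutator_commutator[of "\<ominus> x" I a A] by auto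
  then show ?thesis using xI a by (simp add: gsimps)
qed

text \<open>Cosets are taken in the additive group because so far the commutator is known to be
  normal only there; its ideal property is deduced from this quotient.\<close>

definition comm_coset :: "'a \<Rightarrow> 'a set" where
  "comm_coset a = radrng_commutator A I #>\<^bsub>add_monoid A\<^esub> a"

definition comm_quotient :: "'a set monoid" where
  "comm_quotient = add_monoid A Mod radrng_commutator A I"

lemma comm_coset_eq_iff:
  assumes "a \<in> carrier A" "b \<in> carrier A"
  shows "comm_coset a = comm_coset b \<longleftrightarrow> a \<ominus> b \<in> radrng_commutator A I"
  using group.rcos_self[OF add_group, of a] subgroup_radrng_commutator[OF I_subset]
    group.repr_independence[OF add_group, of a _ b] assms
    subgroup.rcos_module[OF subgroup_radrng_commutator[OF I_subset] add_group, of b a]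
  by (auto simp: comm_coset_def a_minus_def a_inv_def)

lemma normal_radrng_commutator: "radrng_commutator A I \<lhd> add_monoid A"
  using subgroup_radrng_commutator[OF I_subset] radrng_commutator_conj
  by (intro group.normal_invI[OF add_group]) (auto simp: a_minus_def a_inv_def)

text \<open>The commutator generators make \<open>I\<close> central, and the distributor generators
  are the error terms in \<open>distrib\<close>.\<close>

lemma central_quotient_comm: "central_quotient A I comm_quotient comm_coset"
proof -
  let ?J = "radrng_commutator A I"
  have sum: "comm_coset (a \<oplus> b) = comm_coset a \<otimes>\<^bsub>comm_quotient\<^esub> comm_coset b"
    if "a \<in> carrier A" "b \<in> carrier A" for a b
    unfolding comm_coset_def comm_quotient_def
    using normal.rcos_sum[OF normal_radrng_commutator, of a b] that by (simp add: FactGroup_def)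
  show ?thesis
  proof (intro central_quotient.intro central_quotient_axioms.intro skb_with_ideal_axioms,
      goal_cases)
    case 1
    show ?case unfolding comm_quotient_def
      by (rule normal.factorgroup_is_group[OF normal_radrng_commutator])
  next
    case (2 a)
    then show ?case by (auto simp: comm_coset_def comm_quotient_def FactGroup_def RCOSETS_def)
  next
    case (3 a b)
    then show ?case by (rule sum)
  next
    case (4 x a)
    then have "comm_coset (x \<oplus> a) = comm_coset (a \<oplus> x)"
      using radrng_commutator_commutator[of x I a A]
      by (subst comm_coset_eq_iff) (simp_all add: gsimps)
    then show ?case using 4 sum by simp
  next
    case (5 a b d)
    then have "right_distributor A a b d \<in> ?J"
      using radrng_commutator_generators[of _ I _ A] by blast
    moreover have "(a \<oplus> b) \<otimes> d \<ominus> ((a \<otimes> d \<ominus> d) \<oplus> b \<otimes> d) = right_distributor A a b d"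
      using 5 by (simp add: add_mult_eq gsimps)
    ultimately show ?case using 5 by (subst comm_coset_eq_iff) simp_all
  qed
qed

text \<open>All generators are \<open>killed\<close>, and this property passes to sums and negatives
  since both translations are additive on \<open>I\<close> modulo the commutator. Hence translates
  of commutator elements stay in the kernel of \<open>comm_coset\<close>.\<close>

lemma radrng_commutator_ideal: "skb_ideal A (radrng_commutator A I)"
proof -
  let ?J = "radrng_commutator A I"
  interpret cq: central_quotient A I comm_quotient comm_coset
    by (rule central_quotient_comm)
  interpret Q: group comm_quotient by (rule cq.Q)
  have killed: "cq.killed x" if "x \<in> ?J" for x
    using that I_subset
  proof (induction rule: radrng_commutator_induct)
    case zero
    then show ?case
      by (simp add: cq.killed_def cq.q_rho_zero) (simp add: lam_def a_minus_def cq.q_zero)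
  next
    case (neg x)
    then show ?case by (simp add: cq.killed_def cq.q_rho_neg lam_neg cq.q_neg)
  next
    case (add x y)
    then show ?case by (simp add: cq.killed_def cq.q_rho_add lam_add cq.q_add)
  qed (simp_all add: cq.killed_distributor1 cq.killed_distributor2 cq.killed_distributor3
      cq.killed_commutator)
  have J: "y \<in> ?J" if "comm_coset y = \<one>\<^bsub>comm_quotient\<^esub>" "y \<in> carrier A" for y
    using that comm_coset_eq_iff[of y \<zero>] by (simp add: cq.q_zero a_minus_def)
  show ?thesis
    unfolding skb_ideal_def
  proof (intro conjI ballI)
    fix a x assume ax: "a \<in> carrier A" "x \<in> ?J"
    then have "x \<in> carrier A" using radrng_commutator_closed[OF I_subset] by simp
    then show "a \<otimes> x \<ominus> a \<in> ?J" "x \<otimes> a \<ominus> a \<in> ?J"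
      using killed[OF ax(2)] ax by (auto intro!: J simp: cq.killed_def rho_def lam_def)
  qed (use radrng_commutator_closed[OF I_subset] radrng_commutator_conj in auto)
qed

end

lemma (in skb) carrier_ideal: "skb_ideal A (carrier A)"
  by (auto simp: skb_ideal_def)

section \<open>Homomorphisms and their effect on commutators\<close>

locale skb_hom = dom: skb A + cod: skb C
  for A :: "'a ring" (structure) and C :: "'c ring" (structure) +
  fixes f
  assumes hom: "f \<in> ring_hom A C"
begin

lemma f_closed [simp]: "a \<in> carrier A \<Longrightarrow> f a \<in> carrier C"
  and f_add [simp]: "\<lbrakk>a \<in> carrier A; b \<in> carrier A\<rbrakk> \<Longrightarrow> f (a \<oplus> b) = f a \<oplus>\<^bsub>C\<^esub> f b"
  and f_mult [simp]: "\<lbrakk>a \<in> carrier A; b \<in> carrier A\<rbrakk> \<Longrightarrow> f (a \<otimes> b) = f a \<otimes>\<^bsub>C\<^esub> f b"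
  using ring_hom_memE[OF hom] by auto

text \<open>\<open>ring_hom\<close> asks for preservation of \<open>\<one>\<close>; this suffices
  because \<open>\<one>\<close> and \<open>\<zero>\<close> coincide.\<close>

lemma f_zero [simp]: "f \<zero> = \<zero>\<^bsub>C\<^esub>"
  using ring_hom_memE(4)[OF hom] by (simp add: dom.one_eq_zero cod.one_eq_zero)

lemma f_neg [simp]: "a \<in> carrier A \<Longrightarrow> f (\<ominus> a) = \<ominus>\<^bsub>C\<^esub> f a"
proof -
  assume a: "a \<in> carrier A"
  have "f (\<ominus> a) \<oplus>\<^bsub>C\<^esub> f a = f (\<ominus> a \<oplus> a)" using a by (simp only: f_add dom.neg_closed)
  then have "f (\<ominus> a) \<oplus>\<^bsub>C\<^esub> f a = \<ominus>\<^bsub>C\<^esub> f a \<oplus>\<^bsub>C\<^esub> f a" using a by simp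
  then show "f (\<ominus> a) = \<ominus>\<^bsub>C\<^esub> f a" by (subst (asm) cod.add_right_cancel) (use a in simp_all)
qed

lemma f_minus [simp]: "\<lbrakk>a \<in> carrier A; b \<in> carrier A\<rbrakk> \<Longrightarrow> f (a \<ominus> b) = f a \<ominus>\<^bsub>C\<^esub> f b"
  by (simp add: a_minus_def)

lemma f_distributor [simp]:
  "\<lbrakk>a \<in> carrier A; b \<in> carrier A; c \<in> carrier A\<rbrakk> \<Longrightarrow>
    f (right_distributor A a b c) = right_distributor C (f a) (f b) (f c)"
  by (simp add: right_distributor_def)

lemma radrng_commutator_image:
  assumes I: "I \<subseteq> carrier A" and J: "f ` I \<subseteq> J" and v: "v \<in> radrng_commutator A I"
    and JC: "J \<subseteq> carrier C"
  shows "f v \<in> radrng_commutator C J"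
proof -
  have IA: "a \<in> carrier A" "f a \<in> J" if "a \<in> I" for a using that I J by auto
  show ?thesis
    using v I
  proof (induction rule: dom.radrng_commutator_induct)
    case (distributor1 a b c)
    then show ?case using IA radrng_commutator_generators(1)[of "f a" J "f b" C "f c"] by simp
  next
    case (distributor2 a b c)
    then show ?case using IA radrng_commutator_generators(2)[of "f a" J "f b" C "f c"] by simp
  next
    case (distributor3 a b c)
    then show ?case using IA radrng_commutator_generators(3)[of "f a" J "f b" C "f c"] by simp
  next
    case (commutator a b)
    then show ?case using IA radrng_commutator_commutator[of "f a" J "f b" C] by simp
  qed (use cod.radrng_commutator_closed[OF JC] in auto)
qed

text \<open>A generator lifts by lifting its arguments, the one from \<open>J\<close> into
  \<open>I\<close> and the others anywhere. This later lifts elements of [K, X0] along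
  \<open>d1\<close> to commutators of the kernel of \<open>d0\<close>.\<close>

lemma radrng_commutator_lift:
  assumes I: "I \<subseteq> carrier A" and J: "J \<subseteq> f ` I" and surj: "f ` carrier A = carrier C"
    and w: "w \<in> radrng_commutator C J"
  shows "\<exists>v\<in>radrng_commutator A I. f v = w"
proof -
  note cl = dom.radrng_commutator_closed[OF I]
  have JC: "J \<subseteq> carrier C" using I J f_closed by blast
  have lift: "\<exists>a'\<in>carrier A. f a' = a" if "a \<in> carrier C" for a
    using surj that by (metis imageE)
  have liftJ: "\<exists>a'\<in>I. f a' = a" if "a \<in> J" for a using J that by auto
  have IA: "a \<in> carrier A" if "a \<in> I" for a using I that by auto
  from w JC show ?thesis
  proof (induction rule: cod.radrng_commutator_induct)
    case zero
    then show ?case using cl by (intro bexI[of _ \<zero>]) auto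
  next
    case (neg x)
    then obtain v where v: "v \<in> radrng_commutator A I" "f v = x" by auto
    show ?case by (rule bexI[of _ "\<ominus> v"]) (use v cl in auto)
  next
    case (add x y)
    then obtain v u where v: "v \<in> radrng_commutator A I" "f v = x"
      "u \<in> radrng_commutator A I" "f u = y" by auto
    show ?case by (rule bexI[of _ "v \<oplus> u"]) (use v cl in auto)
  next
    case (distributor1 a b c)
    then obtain a' b' c' where *: "a' \<in> I" "f a' = a" "b' \<in> carrier A" "f b' = b"
      "c' \<in> carrier A" "f c' = c" using lift liftJ by metis
    show ?case by (rule bexI[of _ "right_distributor A a' b' c'"])
      (use * IA radrng_commutator_generators in auto)
  next
    case (distributor2 a b c)
    then obtain a' b' c' where *: "a' \<in> I" "f a' = a" "b' \<in> carrier A" "f b' = b"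
      "c' \<in> carrier A" "f c' = c" using lift liftJ by metis
    show ?case by (rule bexI[of _ "right_distributor A b' a' c'"])
      (use * IA radrng_commutator_generators in auto)
  next
    case (distributor3 a b c)
    then obtain a' b' c' where *: "a' \<in> I" "f a' = a" "b' \<in> carrier A" "f b' = b"
      "c' \<in> carrier A" "f c' = c" using lift liftJ by metis
    show ?case by (rule bexI[of _ "right_distributor A b' c' a'"])
      (use * IA radrng_commutator_generators in auto)
  next
    case (commutator a b)
    then obtain a' b' where *: "a' \<in> I" "f a' = a" "b' \<in> carrier A" "f b' = b"
      using lift liftJ by metis
    show ?case by (rule bexI[of _ "(a' \<oplus> b' \<ominus> a') \<ominus> b'"])
      (use * IA radrng_commutator_commutator[of a' I b' A] in auto)
  qed
qed

end

text \<open>With \<open>f u = x u \<oplus> g u\<close> and \<open>x u\<close> in \<open>I\<close>,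
  the images of a generator under \<open>f\<close> and \<open>g\<close> differ only by shifting its
  arguments within cosets of \<open>I\<close>, which changes nothing modulo the commutator of
  \<open>I\<close>.\<close>

lemma radrng_commutator_hom_diff:
  assumes "skb_hom C A f" "skb_hom C A g" "skb_with_ideal A I"
    and diff: "\<And>u. u \<in> carrier C \<Longrightarrow> f u \<ominus>\<^bsub>A\<^esub> g u \<in> I"
    and v: "v \<in> radrng_commutator C (carrier C)"
  shows "f v \<ominus>\<^bsub>A\<^esub> g v \<in> radrng_commutator A I"
proof -
  interpret f: skb_hom C A f by fact
  interpret g: skb_hom C A g by fact
  interpret skb_with_ideal A I by fact
  interpret cq: central_quotient A I comm_quotient comm_coset
    by (rule central_quotient_comm)
  define x where "x u = f u \<ominus>\<^bsub>A\<^esub> g u" for u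
  have x: "x u \<in> I" and f: "f u = x u \<oplus>\<^bsub>A\<^esub> g u" if "u \<in> carrier C" for u
    using that diff by (simp_all add: x_def f.cod.gsimps)
  have "v \<in> carrier C" using v f.dom.radrng_commutator_closed by blast
  have "comm_coset (f v) = comm_coset (g v)"
    using v subset_refl
  proof (induction rule: f.dom.radrng_commutator_induct)
    case (distributor1 a b c)
    then show ?case using cq.q_distributor_cong[of "x a" "x b" "x c" "g a" "g b" "g c"]
      by (simp add: x f[symmetric])
  next
    case (distributor2 a b c)
    then show ?case using cq.q_distributor_cong[of "x b" "x a" "x c" "g b" "g a" "g c"]
      by (simp add: x f[symmetric])
  next
    case (distributor3 a b c)
    then show ?case using cq.q_distributor_cong[of "x b" "x c" "x a" "g b" "g c" "g a"]
      by (simp add: x f[symmetric])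
  next
    case (commutator a b)
    then show ?case using cq.q_commutator_cong[of "x a" "x b" "g a" "g b"]
      by (simp add: x f[symmetric])
  next
    case (add u w)
    then show ?case by (simp add: cq.q_add)
  next
    case (neg u)
    then show ?case by (simp add: cq.q_neg)
  qed simp
  then show ?thesis using \<open>v \<in> carrier C\<close> by (simp add: comm_coset_eq_iff)
qed

section \<open>Images, quotients and sub-braces\<close>

text \<open>The witness \<open>n\<close> stands for the additive inverse, so that negation in a
  newly built record need not be computed beforehand.\<close>

lemma skew_braceI:
  assumes P: "group (add_monoid A)" and M: "group A"
    and brace: "\<And>a b c. \<lbrakk>a \<in> carrier A; b \<in> carrier A; c \<in> carrier A\<rbrakk> \<Longrightarrow>
      \<exists>n\<in>carrier A. n \<oplus>\<^bsub>A\<^esub> a = \<zero>\<^bsub>A\<^esub> \<and> a \<otimes>\<^bsub>A\<^esub> (b \<oplus>\<^bsub>A\<^esub> c) = a \<otimes>\<^bsub>A\<^esub> b \<oplus>\<^bsub>A\<^esub> n \<oplus>\<^bsub>A\<^esub> a \<otimes>\<^bsub>A\<^esub> c"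
  shows "skew_brace A"
  unfolding skew_brace_def
proof (intro conjI P M ballI)
  fix a b c assume abc: "a \<in> carrier A" "b \<in> carrier A" "c \<in> carrier A"
  obtain n where n: "n \<in> carrier A" "n \<oplus>\<^bsub>A\<^esub> a = \<zero>\<^bsub>A\<^esub>"
    "a \<otimes>\<^bsub>A\<^esub> (b \<oplus>\<^bsub>A\<^esub> c) = a \<otimes>\<^bsub>A\<^esub> b \<oplus>\<^bsub>A\<^esub> n \<oplus>\<^bsub>A\<^esub> a \<otimes>\<^bsub>A\<^esub> c"
    using brace[OF abc] by auto
  have "\<ominus>\<^bsub>A\<^esub> a = n" unfolding a_inv_def
    by (rule group.inv_equality[OF P]) (use n abc in simp_all)
  then show "a \<otimes>\<^bsub>A\<^esub> (b \<oplus>\<^bsub>A\<^esub> c) = (a \<otimes>\<^bsub>A\<^esub> b \<ominus>\<^bsub>A\<^esub> a) \<oplus>\<^bsub>A\<^esub> a \<otimes>\<^bsub>A\<^esub> c"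
    using n by (simp add: a_minus_def)
qed

text \<open>The laws are equations between images, and inverses are images of inverses. The form
  suits records built by \<open>Quot\<close>, whose group laws are still to be shown.\<close>

lemma skew_brace_image:
  fixes A :: "'a ring" and C :: "'c ring"
  assumes A: "skew_brace A" and surj: "carrier C = f ` carrier A"
    and add: "\<And>a b. \<lbrakk>a \<in> carrier A; b \<in> carrier A\<rbrakk> \<Longrightarrow> f (a \<oplus>\<^bsub>A\<^esub> b) = f a \<oplus>\<^bsub>C\<^esub> f b"
    and mult: "\<And>a b. \<lbrakk>a \<in> carrier A; b \<in> carrier A\<rbrakk> \<Longrightarrow> f (a \<otimes>\<^bsub>A\<^esub> b) = f a \<otimes>\<^bsub>C\<^esub> f b"
    and zero: "\<zero>\<^bsub>C\<^esub> = f \<zero>\<^bsub>A\<^esub>" and one: "\<one>\<^bsub>C\<^esub> = f \<one>\<^bsub>A\<^esub>"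
  shows "skew_brace C"
proof -
  interpret skb A by (rule skb.intro) fact
  note hom = zero one add[symmetric] mult[symmetric]
  show ?thesis
  proof (rule skew_braceI)
    show "group (add_monoid C)"
    proof (rule groupI, simp_all only: monoid.simps partial_object.simps)
      fix x assume "x \<in> carrier C"
      then obtain a where "a \<in> carrier A" "x = f a" by (auto simp: surj)
      then show "\<exists>y\<in>carrier C. y \<oplus>\<^bsub>C\<^esub> x = \<zero>\<^bsub>C\<^esub>"
        by (intro bexI[of _ "f (\<ominus>\<^bsub>A\<^esub> a)"]) (simp_all add: surj hom)
    qed (auto simp: surj hom add_assoc)
    show "group C"
    proof (rule groupI)
      fix x assume "x \<in> carrier C"
      then obtain a where "a \<in> carrier A" "x = f a" by (auto simp: surj)
      then show "\<exists>y\<in>carrier C. y \<otimes>\<^bsub>C\<^esub> x = \<one>\<^bsub>C\<^esub>"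
        by (intro bexI[of _ "f (inv\<^bsub>A\<^esub> a)"]) (simp_all add: surj hom one_eq_zero)
    qed (auto simp: surj hom mult_assoc one_eq_zero)
    fix x y z assume "x \<in> carrier C" "y \<in> carrier C" "z \<in> carrier C"
    then obtain a b c where abc: "a \<in> carrier A" "x = f a" "b \<in> carrier A" "y = f b"
      "c \<in> carrier A" "z = f c" by (auto simp: surj)
    show "\<exists>n\<in>carrier C. n \<oplus>\<^bsub>C\<^esub> x = \<zero>\<^bsub>C\<^esub> \<and>
        x \<otimes>\<^bsub>C\<^esub> (y \<oplus>\<^bsub>C\<^esub> z) = x \<otimes>\<^bsub>C\<^esub> y \<oplus>\<^bsub>C\<^esub> n \<oplus>\<^bsub>C\<^esub> x \<otimes>\<^bsub>C\<^esub> z"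
      by (rule bexI[of _ "f (\<ominus>\<^bsub>A\<^esub> a)"])
        (use abc in \<open>simp_all add: surj hom brace add_assoc\<close>)
  qed
qed

text \<open>Being a radical ring means that the generators of the full commutator vanish, a
  condition that passes directly along homomorphisms.\<close>

lemma radical_ring_alt:
  assumes "skew_brace A"
  shows "radical_ring A \<longleftrightarrow>
    (\<forall>a\<in>carrier A. \<forall>b\<in>carrier A. \<forall>c\<in>carrier A. right_distributor A a b c = \<zero>\<^bsub>A\<^esub>) \<and>
    (\<forall>a\<in>carrier A. \<forall>b\<in>carrier A. (a \<oplus>\<^bsub>A\<^esub> b \<ominus>\<^bsub>A\<^esub> a) \<ominus>\<^bsub>A\<^esub> b = \<zero>\<^bsub>A\<^esub>)"
proof -
  interpret skb A by (rule skb.intro) fact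
  have "(a \<oplus>\<^bsub>A\<^esub> b) \<otimes>\<^bsub>A\<^esub> c = (a \<otimes>\<^bsub>A\<^esub> c \<ominus>\<^bsub>A\<^esub> c) \<oplus>\<^bsub>A\<^esub> b \<otimes>\<^bsub>A\<^esub> c \<longleftrightarrow> right_distributor A a b c = \<zero>\<^bsub>A\<^esub>"
    if "a \<in> carrier A" "b \<in> carrier A" "c \<in> carrier A" for a b c
  proof
    assume "right_distributor A a b c = \<zero>\<^bsub>A\<^esub>"
    then show "(a \<oplus>\<^bsub>A\<^esub> b) \<otimes>\<^bsub>A\<^esub> c = (a \<otimes>\<^bsub>A\<^esub> c \<ominus>\<^bsub>A\<^esub> c) \<oplus>\<^bsub>A\<^esub> b \<otimes>\<^bsub>A\<^esub> c"
      using that by (simp add: add_mult_eq)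
  qed (use that in \<open>simp add: right_distributor_def gsimps\<close>)
  moreover have "a \<oplus>\<^bsub>A\<^esub> b = b \<oplus>\<^bsub>A\<^esub> a \<longleftrightarrow> (a \<oplus>\<^bsub>A\<^esub> b \<ominus>\<^bsub>A\<^esub> a) \<ominus>\<^bsub>A\<^esub> b = \<zero>\<^bsub>A\<^esub>"
    if "a \<in> carrier A" "b \<in> carrier A" for a b
    using that by (simp add: minus_eq_iff)
  ultimately show ?thesis using skew_brace by (simp add: radical_ring_def)
qed

lemma (in skb_hom) radical_ring_image:
  assumes "radical_ring A" "carrier C = f ` carrier A"
  shows "radical_ring C"
proof -
  have "right_distributor C (f a) (f b) (f c) = \<zero>\<^bsub>C\<^esub>"
    if "a \<in> carrier A" "b \<in> carrier A" "c \<in> carrier A" for a b c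
    using assms(1) that f_distributor[of a b c] by (simp add: radical_ring_alt dom.skew_brace)
  moreover have "(f a \<oplus>\<^bsub>C\<^esub> f b \<ominus>\<^bsub>C\<^esub> f a) \<ominus>\<^bsub>C\<^esub> f b = \<zero>\<^bsub>C\<^esub>"
    if "a \<in> carrier A" "b \<in> carrier A" for a b
  proof -
    have "f ((a \<oplus> b \<ominus> a) \<ominus> b) = \<zero>\<^bsub>C\<^esub>"
      using assms(1) that by (simp add: radical_ring_alt dom.skew_brace del: f_minus)
    then show ?thesis using that by simp
  qed
  ultimately show ?thesis
    unfolding radical_ring_alt[OF cod.skew_brace] assms(2) by blast
qed

text \<open>Equal fibres make \<open>\<alpha> u \<mapsto> \<beta> u\<close> well defined and
  injective; \<open>inv_into\<close> picks a preimage, and \<open>fibre\<close> makes the choice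
  irrelevant.\<close>

lemma common_cover_hom:
  fixes H :: "'h ring" and T :: "'t ring" and M :: "'m ring"
  assumes M: "skew_brace M"
    and H: "carrier H = \<alpha> ` carrier M" "\<zero>\<^bsub>H\<^esub> = \<alpha> \<zero>\<^bsub>M\<^esub>" "\<one>\<^bsub>H\<^esub> = \<alpha> \<one>\<^bsub>M\<^esub>"
      "\<And>u v. \<lbrakk>u \<in> carrier M; v \<in> carrier M\<rbrakk> \<Longrightarrow> \<alpha> (u \<oplus>\<^bsub>M\<^esub> v) = \<alpha> u \<oplus>\<^bsub>H\<^esub> \<alpha> v"
      "\<And>u v. \<lbrakk>u \<in> carrier M; v \<in> carrier M\<rbrakk> \<Longrightarrow> \<alpha> (u \<otimes>\<^bsub>M\<^esub> v) = \<alpha> u \<otimes>\<^bsub>H\<^esub> \<alpha> v"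
    and T: "carrier T = \<beta> ` carrier M" "\<zero>\<^bsub>T\<^esub> = \<beta> \<zero>\<^bsub>M\<^esub>" "\<one>\<^bsub>T\<^esub> = \<beta> \<one>\<^bsub>M\<^esub>"
      "\<And>u v. \<lbrakk>u \<in> carrier M; v \<in> carrier M\<rbrakk> \<Longrightarrow> \<beta> (u \<oplus>\<^bsub>M\<^esub> v) = \<beta> u \<oplus>\<^bsub>T\<^esub> \<beta> v"
      "\<And>u v. \<lbrakk>u \<in> carrier M; v \<in> carrier M\<rbrakk> \<Longrightarrow> \<beta> (u \<otimes>\<^bsub>M\<^esub> v) = \<beta> u \<otimes>\<^bsub>T\<^esub> \<beta> v"
    and fibre: "\<And>u v. \<lbrakk>u \<in> carrier M; v \<in> carrier M\<rbrakk> \<Longrightarrow> \<alpha> u = \<alpha> v \<longleftrightarrow> \<beta> u = \<beta> v"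
  defines "g \<equiv> \<lambda>X. \<beta> (inv_into (carrier M) \<alpha> X)"
  shows "g \<in> ring_iso H T"
proof -
  interpret skb M by (rule skb.intro) fact
  have g: "g (\<alpha> u) = \<beta> u" if "u \<in> carrier M" for u
  proof -
    have "inv_into (carrier M) \<alpha> (\<alpha> u) \<in> carrier M" using that by (simp add: inv_into_into)
    moreover have "\<alpha> (inv_into (carrier M) \<alpha> (\<alpha> u)) = \<alpha> u" using that by (simp add: f_inv_into_f)
    ultimately show ?thesis using fibre that by (simp add: g_def)
  qed
  have "g \<in> ring_hom H T"
    by (rule ring_hom_memI) (auto simp: H(1,3) T(1,3) g H(4,5)[symmetric] T(4,5)[symmetric])
  moreover have "bij_betw g (carrier H) (carrier T)"
    unfolding bij_betw_def inj_on_def H(1) T(1) by (auto simp: image_image g fibre)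
  ultimately show ?thesis by (simp add: ring_iso_def)
qed

lemma common_cover_iso:
  fixes H :: "'h ring" and T :: "'t ring" and M :: "'m ring"
  assumes M: "skew_brace M"
    and H: "carrier H = \<alpha> ` carrier M" "\<zero>\<^bsub>H\<^esub> = \<alpha> \<zero>\<^bsub>M\<^esub>" "\<one>\<^bsub>H\<^esub> = \<alpha> \<one>\<^bsub>M\<^esub>"
      "\<And>u v. \<lbrakk>u \<in> carrier M; v \<in> carrier M\<rbrakk> \<Longrightarrow> \<alpha> (u \<oplus>\<^bsub>M\<^esub> v) = \<alpha> u \<oplus>\<^bsub>H\<^esub> \<alpha> v"
      "\<And>u v. \<lbrakk>u \<in> carrier M; v \<in> carrier M\<rbrakk> \<Longrightarrow> \<alpha> (u \<otimes>\<^bsub>M\<^esub> v) = \<alpha> u \<otimes>\<^bsub>H\<^esub> \<alpha> v"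
    and T: "carrier T = \<beta> ` carrier M" "\<zero>\<^bsub>T\<^esub> = \<beta> \<zero>\<^bsub>M\<^esub>" "\<one>\<^bsub>T\<^esub> = \<beta> \<one>\<^bsub>M\<^esub>"
      "\<And>u v. \<lbrakk>u \<in> carrier M; v \<in> carrier M\<rbrakk> \<Longrightarrow> \<beta> (u \<oplus>\<^bsub>M\<^esub> v) = \<beta> u \<oplus>\<^bsub>T\<^esub> \<beta> v"
      "\<And>u v. \<lbrakk>u \<in> carrier M; v \<in> carrier M\<rbrakk> \<Longrightarrow> \<beta> (u \<otimes>\<^bsub>M\<^esub> v) = \<beta> u \<otimes>\<^bsub>T\<^esub> \<beta> v"
    and fibre: "\<And>u v. \<lbrakk>u \<in> carrier M; v \<in> carrier M\<rbrakk> \<Longrightarrow> \<alpha> u = \<alpha> v \<longleftrightarrow> \<beta> u = \<beta> v"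
    and rad: "radical_ring T"
  shows "radrng_iso H T"
proof -
  have iso: "ring_iso H T \<noteq> {}" using common_cover_hom[where \<alpha> = \<alpha> and \<beta> = \<beta>, OF M H T fibre] by blast
  \<comment> \<open>The isomorphism in the opposite direction carries the radical ring property from
    \<open>T\<close> to \<open>H\<close>.\<close>
  obtain g where g: "g \<in> ring_iso T H"
    using common_cover_hom[where \<alpha> = \<beta> and \<beta> = \<alpha>, OF M T H fibre[symmetric]] by blast
  have "skew_brace H" by (rule skew_brace_image[where f = \<alpha>, OF M H(1) H(4,5,2,3)])
  then have "skb_hom T H g"
    using g rad by (auto simp: skb_hom_def skb_hom_axioms_def skb_def ring_iso_def radical_ring_def)
  moreover have "carrier H = g ` carrier T" using g by (simp add: ring_iso_def bij_betw_def)
  ultimately have "radical_ring H" using skb_hom.radical_ring_image rad by blast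
  then show ?thesis using rad iso by (simp add: radrng_iso_def is_ring_iso_def)
qed

context skb_with_ideal
begin

lemma quot_skew_brace: "skew_brace (A Quot I)"
  by (rule skew_brace_image[OF skew_brace, of _ "(+>) I"]) (simp_all add: quot_simps)

lemma quot_hom: "skb_hom A (A Quot I) ((+>) I)"
  using skew_brace quot_skew_brace
  by (auto simp: skb_hom_def skb_hom_axioms_def skb_def quot_simps intro!: ring_hom_memI)

lemma I_mult: "\<lbrakk>x \<in> I; y \<in> I\<rbrakk> \<Longrightarrow> x \<otimes> y \<in> I"
  using I_add[OF I_mult_right[of x y], of y] by (simp add: gsimps)

text \<open>The element \<open>inv x \<otimes> x \<ominus> inv x\<close> of the ideal equals
  \<open>\<ominus> (inv x)\<close>.\<close>

lemma I_minv: "x \<in> I \<Longrightarrow> inv x \<in> I"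
  using I_neg[OF I_mult_left[of x "inv x"]] by (simp add: a_minus_def)

lemma sub_skew_brace: "skew_brace (A\<lparr>carrier := I\<rparr>)"
proof (rule skew_braceI)
  show "group (add_monoid (A\<lparr>carrier := I\<rparr>))"
  proof (rule groupI)
    fix x assume "x \<in> carrier (add_monoid (A\<lparr>carrier := I\<rparr>))"
    then show "\<exists>y\<in>carrier (add_monoid (A\<lparr>carrier := I\<rparr>)). y \<otimes>\<^bsub>add_monoid (A\<lparr>carrier := I\<rparr>)\<^esub> x =
        \<one>\<^bsub>add_monoid (A\<lparr>carrier := I\<rparr>)\<^esub>"
      by (intro bexI[of _ "\<ominus> x"]) simp_all
  qed (simp_all add: add_assoc)
  show "group (A\<lparr>carrier := I\<rparr>)"
  proof (rule groupI)
    fix x assume "x \<in> carrier (A\<lparr>carrier := I\<rparr>)"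
    then show "\<exists>y\<in>carrier (A\<lparr>carrier := I\<rparr>). y \<otimes>\<^bsub>A\<lparr>carrier := I\<rparr>\<^esub> x = \<one>\<^bsub>A\<lparr>carrier := I\<rparr>\<^esub>"
      by (intro bexI[of _ "inv x"]) (simp_all add: I_minv one_eq_zero)
  qed (simp_all add: mult_assoc I_mult one_eq_zero)
  fix a b c assume "a \<in> carrier (A\<lparr>carrier := I\<rparr>)" "b \<in> carrier (A\<lparr>carrier := I\<rparr>)"
    "c \<in> carrier (A\<lparr>carrier := I\<rparr>)"
  then show "\<exists>n\<in>carrier (A\<lparr>carrier := I\<rparr>). n \<oplus>\<^bsub>A\<lparr>carrier := I\<rparr>\<^esub> a = \<zero>\<^bsub>A\<lparr>carrier := I\<rparr>\<^esub> \<and>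
      a \<otimes>\<^bsub>A\<lparr>carrier := I\<rparr>\<^esub> (b \<oplus>\<^bsub>A\<lparr>carrier := I\<rparr>\<^esub> c) =
      a \<otimes>\<^bsub>A\<lparr>carrier := I\<rparr>\<^esub> b \<oplus>\<^bsub>A\<lparr>carrier := I\<rparr>\<^esub> n \<oplus>\<^bsub>A\<lparr>carrier := I\<rparr>\<^esub> a \<otimes>\<^bsub>A\<lparr>carrier := I\<rparr>\<^esub> c"
    by (intro bexI[of _ "\<ominus> a"]) (simp_all add: brace add_assoc)
qed

lemma sub_hom: "skb_hom (A\<lparr>carrier := I\<rparr>) A id"
  using skew_brace sub_skew_brace
  by (auto simp: skb_hom_def skb_hom_axioms_def skb_def intro!: ring_hom_memI)

lemma sub_ideal:
  assumes "skb_ideal A J" "J \<subseteq> I"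
  shows "skb_ideal (A\<lparr>carrier := I\<rparr>) J"
proof -
  interpret sub: skb_hom "A\<lparr>carrier := I\<rparr>" A id by (rule sub_hom)
  \<comment> \<open>Negation is defined relative to the carrier, so it has to be transferred along
    the inclusion.\<close>
  have "\<ominus>\<^bsub>A\<lparr>carrier := I\<rparr>\<^esub> a = \<ominus> a" if "a \<in> I" for a using sub.f_neg[of a] that by simp
  then show ?thesis
    using assms by (auto simp: skb_ideal_def subset_iff a_minus_def)
qed

end

lemma skb_ideal_Int: "\<lbrakk>skb_ideal A I; skb_ideal A J\<rbrakk> \<Longrightarrow> skb_ideal A (I \<inter> J)"
  by (auto simp: skb_ideal_def)

lemma (in skb) zero_ideal: "skb_ideal A {\<zero>}"
  by (auto simp: skb_ideal_def a_minus_def)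

context skb_hom
begin

lemma ideal_vimage: "skb_ideal C I \<Longrightarrow> skb_ideal A {a \<in> carrier A. f a \<in> I}"
  by (auto simp: skb_ideal_def)

lemma ideal_image:
  assumes "skb_ideal A I" "f ` carrier A = carrier C"
  shows "skb_ideal C (f ` I)"
proof -
  interpret skb_with_ideal A I using assms(1) by unfold_locales
  have "\<ominus>\<^bsub>C\<^esub> f x \<in> f ` I" if "x \<in> I" for x
    using that by (intro image_eqI[of _ _ "\<ominus> x"]) simp_all
  moreover have "f x \<oplus>\<^bsub>C\<^esub> f y \<in> f ` I" if "x \<in> I" "y \<in> I" for x y
    using that by (intro image_eqI[of _ _ "x \<oplus> y"]) simp_all
  moreover have "(f a \<oplus>\<^bsub>C\<^esub> f x) \<ominus>\<^bsub>C\<^esub> f a \<in> f ` I" "f a \<otimes>\<^bsub>C\<^esub> f x \<ominus>\<^bsub>C\<^esub> f a \<in> f ` I"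
    "f x \<otimes>\<^bsub>C\<^esub> f a \<ominus>\<^bsub>C\<^esub> f a \<in> f ` I" if "x \<in> I" "a \<in> carrier A" for x a
    using that imageI[of "(a \<oplus> x) \<ominus> a" I f] imageI[of "a \<otimes> x \<ominus> a" I f]
      imageI[of "x \<otimes> a \<ominus> a" I f] by simp_all
  moreover have "\<zero>\<^bsub>C\<^esub> \<in> f ` I" by (intro image_eqI[of _ _ \<zero>]) simp_all
  ultimately show ?thesis
    unfolding skb_ideal_def assms(2)[symmetric] by auto
qed

end

section \<open>The Hopf formula for a truncated resolution\<close>

lemma mem_a_kernel: "x \<in> a_kernel A C h \<longleftrightarrow> x \<in> carrier A \<and> h x = \<zero>\<^bsub>C\<^esub>"
  by (simp add: a_kernel_def kernel_def)

lemma moore_term_1: "moore_term 1 X Y d = carrier X \<inter> a_kernel X Y (d 0)"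
  and moore_term_2: "moore_term 2 X Y d = carrier X \<inter> a_kernel X Y (d 0) \<inter> a_kernel X Y (d 1)"
  by (auto simp: moore_term_def less_Suc_eq numeral_2_eq_2)

section \<open>The reflector on objects and maps, through cosets of the full commutator\<close>

context skb
begin

abbreviation D :: "'a set" where "D \<equiv> radrng_commutator A (carrier A)"

lemma D_ideal: "skb_with_ideal A D"
proof -
  interpret skb_with_ideal A "carrier A" using carrier_ideal by unfold_locales
  show ?thesis using radrng_commutator_ideal by unfold_locales
qed

lemma G_hom: "skb_hom A (G_obj A) ((+>) D)"
  unfolding G_obj_def by (rule skb_with_ideal.quot_hom[OF D_ideal])

lemma carrier_G_obj: "carrier (G_obj A) = (+>) D ` carrier A"
  unfolding G_obj_def by (rule skb_with_ideal.quot_simps[OF D_ideal])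

lemma G_class_eq_iff:
  "\<lbrakk>a \<in> carrier A; b \<in> carrier A\<rbrakk> \<Longrightarrow> D +> a = D +> b \<longleftrightarrow> a \<ominus> b \<in> D"
  by (rule skb_with_ideal.coset_eq_iff[OF D_ideal])

lemma G_class_zero_iff: "a \<in> carrier A \<Longrightarrow> D +> a = \<zero>\<^bsub>G_obj A\<^esub> \<longleftrightarrow> a \<in> D"
  unfolding G_obj_def
  by (simp add: FactRing_def skb_with_ideal.coset_eq_I_iff[OF D_ideal])

end

lemma (in skb_hom) f_D: "v \<in> dom.D \<Longrightarrow> f v \<in> cod.D"
  by (rule radrng_commutator_image[of "carrier A"]) auto

text \<open>\<open>G_map\<close> is a union over the coset of \<open>a\<close>; all its members give
  one class, since \<open>f\<close> maps commutators to commutators.\<close>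

lemma (in skb_hom) G_map_class:
  assumes a: "a \<in> carrier A"
  shows "G_map C f (dom.D +> a) = cod.D +>\<^bsub>C\<^esub> f a"
proof -
  interpret DA: skb_with_ideal A dom.D by (rule dom.D_ideal)
  have "cod.D +>\<^bsub>C\<^esub> f x = cod.D +>\<^bsub>C\<^esub> f a" if x: "x \<in> dom.D +> a" for x
  proof -
    obtain v where v: "v \<in> dom.D" "x = v \<oplus> a" using x unfolding DA.in_coset_iff[OF a] by auto
    then show ?thesis using a f_D[OF v(1)] DA.I_carrier
      by (subst cod.G_class_eq_iff) (simp_all add: cod.gsimps)
  qed
  then show ?thesis unfolding G_map_def using DA.coset_self[OF a] by blast
qed

lemma (in skb_hom) G_kernel_iff:
  assumes a: "a \<in> carrier A"
  shows "dom.D +> a \<in> a_kernel (G_obj A) (G_obj C) (G_map C f) \<longleftrightarrow> f a \<in> cod.D"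
  using a by (simp add: mem_a_kernel dom.carrier_G_obj G_map_class cod.G_class_zero_iff)

text \<open>The properties of the comonadic resolution from which the formula follows.
  \<open>d_e\<close> lists simplicial identities, \<open>d_s\<close> makes \<open>s\<close> a
  degeneracy, \<open>d_diff\<close> and \<open>d_lift\<close> replace the augmentation with kernel
  \<open>K\<close>, and \<open>exact\<close> is exactness in degree 1 before the reflector is
  applied.\<close>

locale truncated_resolution =
  X0: skb X0 + X1: skb X1 + X2: skb X2 +
  d0: skb_hom X1 X0 d0 + d1: skb_hom X1 X0 d1 +
  e0: skb_hom X2 X1 e0 + e1: skb_hom X2 X1 e1 + e2: skb_hom X2 X1 e2 +
  s: skb_hom X0 X1 s + K: skb_with_ideal X0 K
  for X0 :: "'z ring" and X1 :: "'y ring" and X2 :: "'x ring"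
    and d0 d1 :: "'y \<Rightarrow> 'z" and e0 e1 e2 :: "'x \<Rightarrow> 'y" and s K +
  assumes d_s: "x \<in> carrier X0 \<Longrightarrow> d0 (s x) = x" "x \<in> carrier X0 \<Longrightarrow> d1 (s x) = x"
    and d_diff: "u \<in> carrier X1 \<Longrightarrow> d1 u \<ominus>\<^bsub>X0\<^esub> d0 u \<in> K"
    and d_lift: "k \<in> K \<Longrightarrow> \<exists>u\<in>carrier X1. d0 u = \<zero>\<^bsub>X0\<^esub> \<and> d1 u = k"
    and d_e: "w \<in> carrier X2 \<Longrightarrow> d0 (e1 w) = d0 (e0 w)"
      "w \<in> carrier X2 \<Longrightarrow> d1 (e2 w) = d1 (e1 w)"
      "w \<in> carrier X2 \<Longrightarrow> d0 (e2 w) = d1 (e0 w)"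
    and exact: "\<lbrakk>u \<in> carrier X1; d0 u = \<zero>\<^bsub>X0\<^esub>; d1 u = \<zero>\<^bsub>X0\<^esub>\<rbrakk> \<Longrightarrow>
      \<exists>w\<in>carrier X2. e0 w = \<zero>\<^bsub>X1\<^esub> \<and> e1 w = \<zero>\<^bsub>X1\<^esub> \<and> e2 w = u"
begin

abbreviation J :: "'z set" where "J \<equiv> radrng_commutator X0 K"

text \<open>Representatives in \<open>X1\<close> of the Moore cycles, normalized so that
  \<open>d0\<close> is zero and not merely a commutator.\<close>

definition cycles :: "'y set" where
  "cycles = {u \<in> carrier X1. d0 u = \<zero>\<^bsub>X0\<^esub> \<and> d1 u \<in> X0.D}"

text \<open>Described through \<open>J\<close> instead of as an image under \<open>e2\<close>;
  \<open>moore_boundaries\<close> shows that the classes are the Moore boundaries.\<close>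

definition boundaries :: "'y set" where
  "boundaries = {u \<in> carrier X1. d0 u = \<zero>\<^bsub>X0\<^esub> \<and> d1 u \<in> J}"

abbreviation cls :: "'y \<Rightarrow> 'y set" where "cls u \<equiv> X1.D +>\<^bsub>X1\<^esub> u"

sublocale J: skb_with_ideal X0 J
  using K.radrng_commutator_ideal by unfold_locales

sublocale D0: skb_with_ideal X0 X0.D by (rule X0.D_ideal)

sublocale D1: skb_with_ideal X1 X1.D by (rule X1.D_ideal)

sublocale cls: skb_hom X1 "G_obj X1" cls by (rule X1.G_hom)

lemma J_D: "J \<subseteq> X0.D" and J_K: "J \<subseteq> K"
  using X0.radrng_commutator_mono[OF K.I_subset] K.radrng_commutator_subset by auto

lemma d_diff_D: "v \<in> X1.D \<Longrightarrow> d1 v \<ominus>\<^bsub>X0\<^esub> d0 v \<in> J"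
  by (rule radrng_commutator_hom_diff[OF d1.skb_hom_axioms d0.skb_hom_axioms K.skb_with_ideal_axioms
        d_diff])

lemma d1_D: "\<lbrakk>v \<in> X1.D; d0 v = \<zero>\<^bsub>X0\<^esub>\<rbrakk> \<Longrightarrow> d1 v \<in> J"
  using d_diff_D[of v] D1.I_carrier[of v] by (simp add: a_minus_def)

lemma cycles_ideal: "skb_ideal X1 cycles"
proof -
  have "cycles = {u \<in> carrier X1. d0 u \<in> {\<zero>\<^bsub>X0\<^esub>}} \<inter> {u \<in> carrier X1. d1 u \<in> X0.D}"
    by (auto simp: cycles_def)
  then show ?thesis
    by (simp only: skb_ideal_Int d0.ideal_vimage[OF X0.zero_ideal] d1.ideal_vimage[OF D0.ideal])
qed

lemma boundaries_ideal: "skb_ideal X1 boundaries"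
proof -
  have "boundaries = {u \<in> carrier X1. d0 u \<in> {\<zero>\<^bsub>X0\<^esub>}} \<inter> {u \<in> carrier X1. d1 u \<in> J}"
    by (auto simp: boundaries_def)
  then show ?thesis
    by (simp only: skb_ideal_Int d0.ideal_vimage[OF X0.zero_ideal] d1.ideal_vimage[OF J.ideal])
qed

lemma boundaries_cycles: "boundaries \<subseteq> cycles"
  using J_D by (auto simp: cycles_def boundaries_def)

text \<open>The degenerate element \<open>s (d0 u)\<close> has class zero, and subtracting it moves \<open>u\<close> into
  \<open>Ker d0\<close>.\<close>

lemma cls_normalize:
  assumes "u \<in> carrier X1" "d0 u \<in> X0.D"
  shows "cls (u \<ominus>\<^bsub>X1\<^esub> s (d0 u)) = cls u"
proof -
  have "s (d0 u) \<in> X1.D" by (rule s.f_D[OF assms(2)])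
  then have "u \<oplus>\<^bsub>X1\<^esub> (\<ominus>\<^bsub>X1\<^esub> s (d0 u) \<oplus>\<^bsub>X1\<^esub> \<ominus>\<^bsub>X1\<^esub> u) \<in> X1.D"
    using assms(1) by (intro D1.I_conj') simp_all
  then show ?thesis
    using assms(1) by (subst X1.G_class_eq_iff) (simp_all add: X1.gsimps)
qed

text \<open>A Moore cycle is the class of some \<open>u\<close> with both faces in the commutator.
  Subtracting \<open>s (d0 u)\<close> keeps the class, makes \<open>d0\<close> zero, and changes
  \<open>d1\<close> by a commutator element.\<close>

lemma moore_cycles:
  assumes "d 0 = d0" "d 1 = d1"
  shows "moore_term 1 (G_obj X1) (G_obj X0) (\<lambda>i. G_map X0 (d i)) \<inter>
     a_kernel (G_obj X1) (G_obj X0) (G_map X0 (d 1)) = cls ` cycles" (is "?Z = _")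
proof
  have Z: "x \<in> ?Z \<longleftrightarrow> (\<exists>u\<in>carrier X1. x = cls u \<and> d0 u \<in> X0.D \<and> d1 u \<in> X0.D)" for x
    unfolding moore_term_1 assms
    by (auto simp: X1.carrier_G_obj d0.G_kernel_iff d1.G_kernel_iff)
  show "cls ` cycles \<subseteq> ?Z"
  proof
    fix x assume "x \<in> cls ` cycles"
    then show "x \<in> ?Z" unfolding Z by (auto simp: cycles_def)
  qed
  show "?Z \<subseteq> cls ` cycles"
  proof
    fix x assume "x \<in> ?Z"
    then obtain u where u: "u \<in> carrier X1" "x = cls u" "d0 u \<in> X0.D" "d1 u \<in> X0.D"
      unfolding Z by auto
    then have "u \<ominus>\<^bsub>X1\<^esub> s (d0 u) \<in> cycles"
      by (simp add: cycles_def d_s a_minus_def)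
    then show "x \<in> cls ` cycles" using cls_normalize u by (metis imageI)
  qed
qed

lemma moore_boundaries:
  assumes "e 0 = e0" "e 1 = e1" "e 2 = e2"
  shows "G_map X1 (e (Suc 1)) ` moore_term (Suc 1) (G_obj X2) (G_obj X1) (\<lambda>i. G_map X1 (e i)) =
     cls ` boundaries" (is "?B = _")
proof
  have eq: "Suc 1 = 2" by simp
  have B: "x \<in> ?B \<longleftrightarrow> (\<exists>w\<in>carrier X2. x = cls (e2 w) \<and> e0 w \<in> X1.D \<and> e1 w \<in> X1.D)" for x
    unfolding eq moore_term_2 assms
    by (auto simp: X2.carrier_G_obj e0.G_kernel_iff e1.G_kernel_iff e2.G_map_class
        intro!: image_eqI[of _ _ "X2.D +>\<^bsub>X2\<^esub> w" for w])
  show "?B \<subseteq> cls ` boundaries"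
  proof
    fix x assume "x \<in> ?B"
    then obtain w where w: "w \<in> carrier X2" "x = cls (e2 w)" "e0 w \<in> X1.D" "e1 w \<in> X1.D"
      unfolding B by auto
    let ?u = "e2 w \<ominus>\<^bsub>X1\<^esub> s (d0 (e2 w))"
    \<comment> \<open>By the simplicial identity this face is \<open>d1 (e0 w)\<close>, so the
      normalization used for cycles applies.\<close>
    have "d0 (e2 w) \<in> X0.D" using w d1.f_D by (simp add: d_e)
    then have x: "x = cls ?u" using cls_normalize[OF e2.f_closed[OF w(1)]] w(2) by (simp only:)
    \<comment> \<open>The simplicial identities give \<open>d1 (e1 w)\<close> minus
      \<open>d1 (e0 w)\<close>. Inserting the equal terms \<open>d0 (e1 w)\<close> and
      \<open>d0 (e0 w)\<close> yields two differences to which \<open>d_diff_D\<close>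
      applies.\<close>
    have "d1 ?u = (d1 (e1 w) \<ominus>\<^bsub>X0\<^esub> d0 (e1 w)) \<oplus>\<^bsub>X0\<^esub> \<ominus>\<^bsub>X0\<^esub> (d1 (e0 w) \<ominus>\<^bsub>X0\<^esub> d0 (e0 w))"
      using w by (simp add: d_s d_e X0.gsimps)
    also have "\<dots> \<in> J" using w d_diff_D by (intro J.I_add J.I_neg)
    finally have "?u \<in> boundaries" using w by (simp add: boundaries_def d_s d_e a_minus_def)
    then show "x \<in> cls ` boundaries" using x by blast
  qed
  show "cls ` boundaries \<subseteq> ?B"
  proof
    fix x assume "x \<in> cls ` boundaries"
    then obtain u where u: "u \<in> carrier X1" "d0 u = \<zero>\<^bsub>X0\<^esub>" "d1 u \<in> J" "x = cls u"
      by (auto simp: boundaries_def)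
    let ?N = "{u \<in> carrier X1. d0 u = \<zero>\<^bsub>X0\<^esub>}"
    have N: "skb_with_ideal X1 ?N"
      using d0.ideal_vimage[OF X0.zero_ideal] by unfold_locales simp
    have "K \<subseteq> d1 ` ?N" using d_lift by blast
    moreover have "d1 ` carrier X1 = carrier X0"
    proof
      show "carrier X0 \<subseteq> d1 ` carrier X1"
        using d_s(2) s.f_closed by (metis image_eqI subsetI)
    qed (use d1.f_closed in blast)
    \<comment> \<open>Since \<open>d1\<close> is onto and maps \<open>?N\<close>, the kernel of
      \<open>d0\<close>, onto a set containing \<open>K\<close>, the element \<open>d1 u\<close> of
      \<open>J\<close> lifts to a commutator of \<open>?N\<close>.\<close>
    ultimately obtain v where v: "v \<in> radrng_commutator X1 ?N" "d1 v = d1 u"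
      using d1.radrng_commutator_lift[OF skb_with_ideal.I_subset[OF N] _ _ u(3)] by blast
    have vN: "v \<in> carrier X1" "d0 v = \<zero>\<^bsub>X0\<^esub>" using skb_with_ideal.radrng_commutator_subset[OF N v(1)] by blast+
    have vD: "v \<in> X1.D" using X1.radrng_commutator_mono[OF skb_with_ideal.I_subset[OF N]] v(1) by (rule subsetD)
    \<comment> \<open>Both faces of \<open>u\<close> minus \<open>v\<close> vanish, so exactness
      applies; as \<open>v\<close> is in the commutator, the class is still that of
      \<open>u\<close>.\<close>
    obtain w where w: "w \<in> carrier X2" "e0 w = \<zero>\<^bsub>X1\<^esub>" "e1 w = \<zero>\<^bsub>X1\<^esub>"
      "e2 w = u \<ominus>\<^bsub>X1\<^esub> v"
      using exact[of "u \<ominus>\<^bsub>X1\<^esub> v"] u v vN by (auto simp: a_minus_def)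
    have "u \<oplus>\<^bsub>X1\<^esub> (\<ominus>\<^bsub>X1\<^esub> v \<oplus>\<^bsub>X1\<^esub> \<ominus>\<^bsub>X1\<^esub> u) \<in> X1.D"
      using u vD by (intro D1.I_conj') simp_all
    then have "cls (u \<ominus>\<^bsub>X1\<^esub> v) = cls u"
      using u vN by (subst X1.G_class_eq_iff) (simp_all add: X1.gsimps)
    then have "x = cls (e2 w)" using w(4) u(4) by (simp only:)
    then show "x \<in> ?B" unfolding B using w(1-3) D1.I_zero by auto
  qed
qed

lemma cycles_D:
  assumes "u \<in> cycles"
  shows "u \<in> carrier X1" "d0 u = \<zero>\<^bsub>X0\<^esub>" "d1 u \<in> K \<inter> X0.D"
proof -
  show u: "u \<in> carrier X1" "d0 u = \<zero>\<^bsub>X0\<^esub>"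
    using assms by (auto simp: cycles_def)
  show "d1 u \<in> K \<inter> X0.D" using d_diff[OF u(1)] assms u by (simp add: cycles_def a_minus_def)
qed

lemma d1_cycles: "d1 ` cycles = K \<inter> X0.D"
proof
  show "d1 ` cycles \<subseteq> K \<inter> X0.D" using cycles_D by auto
  show "K \<inter> X0.D \<subseteq> d1 ` cycles"
  proof
    fix k assume k: "k \<in> K \<inter> X0.D"
    then obtain u where "u \<in> carrier X1" "d0 u = \<zero>\<^bsub>X0\<^esub>" "d1 u = k" using d_lift by blast
    then show "k \<in> d1 ` cycles" using k by (auto simp: cycles_def)
  qed
qed

text \<open>Two representatives of a class in the kernel of \<open>d0\<close> differ by a commutator
  element \<open>r\<close> with \<open>d0 r = 0\<close>, and \<open>d1 r\<close> lies in
  \<open>J\<close> by \<open>d1_D\<close>. So membership of \<open>d1 w\<close> in \<open>J\<close>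
  depends only on the class.\<close>

lemma cls_boundaries_iff:
  assumes w: "w \<in> carrier X1" "d0 w = \<zero>\<^bsub>X0\<^esub>"
  shows "cls w \<in> cls ` boundaries \<longleftrightarrow> d1 w \<in> J"
proof
  assume "cls w \<in> cls ` boundaries"
  then obtain m where m: "m \<in> boundaries" "cls w = cls m" by auto
  have mc: "m \<in> carrier X1" "d0 m = \<zero>\<^bsub>X0\<^esub>" "d1 m \<in> J"
    using m by (auto simp: boundaries_def)
  define r where "r = w \<ominus>\<^bsub>X1\<^esub> m"
  have r: "r \<in> X1.D" "d0 r = \<zero>\<^bsub>X0\<^esub>"
    using m w mc X1.G_class_eq_iff[of w m] by (simp_all add: r_def a_minus_def)
  have "w = r \<oplus>\<^bsub>X1\<^esub> m" using w mc by (simp add: r_def X1.gsimps)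
  then have "d1 w = d1 r \<oplus>\<^bsub>X0\<^esub> d1 m" using r mc by simp
  then show "d1 w \<in> J" using d1_D[OF r] mc by simp
qed (use w in \<open>simp add: boundaries_def\<close>)

lemma cycle_ring_ideal: "skb_with_ideal (G_obj X1\<lparr>carrier := cls ` cycles\<rparr>) (cls ` boundaries)"
  and boundary_ideal: "skb_with_ideal (G_obj X1) (cls ` boundaries)"
proof -
  have surj: "cls ` carrier X1 = carrier (G_obj X1)" by (simp add: X1.carrier_G_obj)
  have Z: "skb_with_ideal (G_obj X1) (cls ` cycles)"
    using cls.ideal_image[OF cycles_ideal surj] by unfold_locales
  show "skb_with_ideal (G_obj X1) (cls ` boundaries)"
    using cls.ideal_image[OF boundaries_ideal surj] by unfold_locales
  then have "skb_ideal (G_obj X1\<lparr>carrier := cls ` cycles\<rparr>) (cls ` boundaries)"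
    by (intro skb_with_ideal.sub_ideal[OF Z] skb_with_ideal.ideal image_mono boundaries_cycles)
  then show "skb_with_ideal (G_obj X1\<lparr>carrier := cls ` cycles\<rparr>) (cls ` boundaries)"
    using skb_with_ideal.sub_skew_brace[OF Z]
    by (simp add: skb_with_ideal_def skb_with_ideal_axioms_def skb_def)
qed

lemma KD_ideal: "skb_with_ideal X0 (K \<inter> X0.D)"
  using skb_ideal_Int[OF K.ideal D0.ideal] by unfold_locales

lemma J_sub_ideal: "skb_with_ideal (X0\<lparr>carrier := K \<inter> X0.D\<rparr>) J"
  using skb_with_ideal.sub_skew_brace[OF KD_ideal]
    skb_with_ideal.sub_ideal[OF KD_ideal J.ideal] J_K J_D
  by (simp add: skb_with_ideal_def skb_with_ideal_axioms_def skb_def)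

text \<open>Distributors and commutators of elements of \<open>K\<close> are already generators of
  \<open>J\<close>, hence vanish in the quotient.\<close>

lemma radical_ring_hopf: "radical_ring (X0\<lparr>carrier := K \<inter> X0.D\<rparr> Quot J)"
proof -
  let ?S = "X0\<lparr>carrier := K \<inter> X0.D\<rparr>" let ?T = "?S Quot J"
  interpret inc: skb_hom ?S X0 id by (rule skb_with_ideal.sub_hom[OF KD_ideal])
  interpret q: skb_hom ?S ?T "(+>\<^bsub>?S\<^esub>) J" by (rule skb_with_ideal.quot_hom[OF J_sub_ideal])
  have zero: "J +>\<^bsub>?S\<^esub> x = \<zero>\<^bsub>?T\<^esub>" if "x \<in> J" for x
    using that skb_with_ideal.coset_eq_I_iff[OF J_sub_ideal, of x] J_K J_D
    by (auto simp: FactRing_def)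
  have dist: "right_distributor ?T (J +>\<^bsub>?S\<^esub> a) (J +>\<^bsub>?S\<^esub> b) (J +>\<^bsub>?S\<^esub> c) = \<zero>\<^bsub>?T\<^esub>"
    if "a \<in> carrier ?S" "b \<in> carrier ?S" "c \<in> carrier ?S" for a b c
  proof -
    \<comment> \<open>The inclusion identifies distributors formed in the restricted record with
      those of \<open>X0\<close>.\<close>
    have "right_distributor ?S a b c = right_distributor X0 a b c"
      using inc.f_distributor[OF that] by simp
    also have "\<dots> \<in> J" using that by (intro radrng_commutator_generators(1)) simp_all
    finally show ?thesis using zero q.f_distributor[OF that] by simp
  qed
  have comm: "((J +>\<^bsub>?S\<^esub> a) \<oplus>\<^bsub>?T\<^esub> (J +>\<^bsub>?S\<^esub> b) \<ominus>\<^bsub>?T\<^esub> (J +>\<^bsub>?S\<^esub> a)) \<ominus>\<^bsub>?T\<^esub> (J +>\<^bsub>?S\<^esub> b) = \<zero>\<^bsub>?T\<^esub>"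
    if "a \<in> carrier ?S" "b \<in> carrier ?S" for a b
  proof -
    have cl: "a \<oplus>\<^bsub>?S\<^esub> b \<in> carrier ?S" "a \<oplus>\<^bsub>?S\<^esub> b \<ominus>\<^bsub>?S\<^esub> a \<in> carrier ?S"
      by (intro inc.dom.add_closed inc.dom.minus_closed that)+
    have "id ((a \<oplus>\<^bsub>?S\<^esub> b \<ominus>\<^bsub>?S\<^esub> a) \<ominus>\<^bsub>?S\<^esub> b) = (a \<oplus>\<^bsub>X0\<^esub> b \<ominus>\<^bsub>X0\<^esub> a) \<ominus>\<^bsub>X0\<^esub> b"
      using inc.f_minus[OF cl(2) that(2)] inc.f_minus[OF cl(1) that(1)] inc.f_add[OF that]
      by (simp only: id_apply)
    also have "\<dots> \<in> J" using that by (intro radrng_commutator_commutator) simp_all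
    finally have "J +>\<^bsub>?S\<^esub> ((a \<oplus>\<^bsub>?S\<^esub> b \<ominus>\<^bsub>?S\<^esub> a) \<ominus>\<^bsub>?S\<^esub> b) = \<zero>\<^bsub>?T\<^esub>" by (simp only: id_apply zero)
    then show ?thesis
      using that by (simp only: q.f_minus q.f_add inc.dom.add_closed inc.dom.minus_closed)
  qed
  show ?thesis
    unfolding radical_ring_alt[OF skb_with_ideal.quot_skew_brace[OF J_sub_ideal]]
      skb_with_ideal.quot_simps(1)[OF J_sub_ideal]
    using dist comm by blast
qed

text \<open>Both sides are quotients of the skew brace of \<open>cycles\<close>: one by taking
  classes modulo boundaries, the other by applying \<open>d1\<close> modulo \<open>J\<close>. By
  \<open>cls_boundaries_iff\<close> the two maps have the same fibres.\<close>

lemma hopf_formula: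
  assumes d: "d 0 = d0" "d 1 = d1" and e: "e 0 = e0" "e 1 = e1" "e 2 = e2"
  shows "radrng_iso
    (moore_homology 1 (G_obj X2) (G_obj X1) (G_obj X0)
      (\<lambda>i. G_map X1 (e i)) (\<lambda>i. G_map X0 (d i)))
    (X0\<lparr>carrier := K \<inter> X0.D\<rparr> Quot J)" (is "radrng_iso ?H ?T")
proof -
  let ?L = "X1\<lparr>carrier := cycles\<rparr>"
  let ?Z = "G_obj X1\<lparr>carrier := cls ` cycles\<rparr>" and ?B = "cls ` boundaries"
  let ?S = "X0\<lparr>carrier := K \<inter> X0.D\<rparr>"
  note Zq = skb_with_ideal.quot_simps[OF cycle_ring_ideal]
    and Sq = skb_with_ideal.quot_simps[OF J_sub_ideal]
  have L: "skb_with_ideal X1 cycles" using cycles_ideal by unfold_locales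
  have H: "?H = ?Z Quot ?B"
    unfolding moore_homology_def moore_cycles[of d, OF d] moore_boundaries[of e, OF e] ..
  \<comment> \<open>Shrinking the carrier does not change cosets as sets, so the criteria for the
    ambient structures apply.\<close>
  have cosetZ: "?B +>\<^bsub>?Z\<^esub> x = ?B +>\<^bsub>G_obj X1\<^esub> x" for x
    by (simp add: a_r_coset_def r_coset_def)
  have cosetS: "J +>\<^bsub>?S\<^esub> x = J +>\<^bsub>X0\<^esub> x" for x
    by (simp add: a_r_coset_def r_coset_def)
  let ?\<alpha> = "\<lambda>u. ?B +>\<^bsub>?Z\<^esub> cls u" and ?\<beta> = "\<lambda>u. J +>\<^bsub>?S\<^esub> d1 u"
  have fibre: "?\<alpha> u = ?\<alpha> v \<longleftrightarrow> ?\<beta> u = ?\<beta> v" if "u \<in> cycles" "v \<in> cycles" for u v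
  proof -
    note uv = cycles_D[OF that(1)] cycles_D[OF that(2)]
    have "?\<alpha> u = ?\<alpha> v \<longleftrightarrow> cls (u \<ominus>\<^bsub>X1\<^esub> v) \<in> ?B"
      unfolding cosetZ using uv by (subst skb_with_ideal.coset_eq_iff[OF boundary_ideal]) simp_all
    also have "\<dots> \<longleftrightarrow> d1 u \<ominus>\<^bsub>X0\<^esub> d1 v \<in> J"
      using uv by (subst cls_boundaries_iff) (simp_all add: a_minus_def)
    also have "\<dots> \<longleftrightarrow> ?\<beta> u = ?\<beta> v"
      unfolding cosetS using uv by (subst J.coset_eq_iff) simp_all
    finally show ?thesis .
  qed
  show ?thesis unfolding H
  proof (rule common_cover_iso[where M = ?L and \<alpha> = ?\<alpha> and \<beta> = ?\<beta>])
    show "skew_brace ?L" by (rule skb_with_ideal.sub_skew_brace[OF L])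
    show "carrier (?Z Quot ?B) = ?\<alpha> ` carrier ?L"
      by (simp only: Zq) (simp add: image_image)
    show "carrier ?T = ?\<beta> ` carrier ?L"
      by (simp only: Sq) (simp add: d1_cycles[symmetric] image_image)
    show "\<zero>\<^bsub>?Z Quot ?B\<^esub> = ?\<alpha> \<zero>\<^bsub>?L\<^esub>" "\<one>\<^bsub>?Z Quot ?B\<^esub> = ?\<alpha> \<one>\<^bsub>?L\<^esub>"
      by (simp_all only: Zq) (simp_all add: X1.one_eq_zero cls.cod.one_eq_zero)
    show "\<zero>\<^bsub>?T\<^esub> = ?\<beta> \<zero>\<^bsub>?L\<^esub>" "\<one>\<^bsub>?T\<^esub> = ?\<beta> \<one>\<^bsub>?L\<^esub>"
      by (simp_all only: Sq) (simp_all add: X1.one_eq_zero X0.one_eq_zero)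
    fix u v assume "u \<in> carrier ?L" "v \<in> carrier ?L"
    then have uv: "u \<in> cycles" "v \<in> cycles" by simp_all
    have Z: "cls u \<in> carrier ?Z" "cls v \<in> carrier ?Z" using uv by simp_all
    have S: "d1 u \<in> carrier ?S" "d1 v \<in> carrier ?S" using uv[THEN cycles_D(3)] by simp_all
    show "?\<alpha> (u \<oplus>\<^bsub>?L\<^esub> v) = ?\<alpha> u \<oplus>\<^bsub>?Z Quot ?B\<^esub> ?\<alpha> v"
      "?\<alpha> (u \<otimes>\<^bsub>?L\<^esub> v) = ?\<alpha> u \<otimes>\<^bsub>?Z Quot ?B\<^esub> ?\<alpha> v"
      unfolding Zq(4,5)[OF Z] using uv[THEN cycles_D(1)] by simp_all
    show "?\<beta> (u \<oplus>\<^bsub>?L\<^esub> v) = ?\<beta> u \<oplus>\<^bsub>?T\<^esub> ?\<beta> v"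
      "?\<beta> (u \<otimes>\<^bsub>?L\<^esub> v) = ?\<beta> u \<otimes>\<^bsub>?T\<^esub> ?\<beta> v"
      unfolding Sq(4,5)[OF S] using uv[THEN cycles_D(1)] by simp_all
    show "?\<alpha> u = ?\<alpha> v \<longleftrightarrow> ?\<beta> u = ?\<beta> v" using uv by (rule fibre)
  qed (rule radical_ring_hopf)
qed

end

section \<open>The comonadic resolution\<close>

lemma skb_homI: "\<lbrakk>skew_brace A; skew_brace C; f \<in> ring_hom A C\<rbrakk> \<Longrightarrow> skb_hom A C f"
  by (simp add: skb_hom_def skb_hom_axioms_def skb_def)

lemma skb_hom_comp:
  assumes "skb_hom A C f" "skb_hom C E g"
  shows "skb_hom A E (\<lambda>x. g (f x))"
proof -
  interpret f: skb_hom A C f by fact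
  interpret g: skb_hom C E g by fact
  show ?thesis
    using ring_hom_memE[OF f.hom] ring_hom_memE[OF g.hom]
    by (intro skb_homI f.dom.skew_brace g.cod.skew_brace ring_hom_memI) simp_all
qed

lemma skb_hom_ident: "skew_brace A \<Longrightarrow> skb_hom A A (\<lambda>x. x)"
  by (intro skb_homI ring_hom_memI) simp_all

lemma skew_brace_T_obj: "skew_brace (T_obj B)"
  by (simp add: T_obj_def skew_brace_free_skb)

abbreviation gen :: "'a ring \<Rightarrow> 'a \<Rightarrow> 'a skb_term set" where
  "gen B \<equiv> free_unit (carrier B)"

lemma gen_closed: "x \<in> carrier B \<Longrightarrow> gen B x \<in> carrier (T_obj B)"
  by (simp add: T_obj_def free_unit_closed)

text \<open>Both maps are the free lift of their common values on generators. The simplicial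
  identities below are all checked this way.\<close>

lemma T_hom_eqI:
  assumes g: "skb_hom (T_obj B) A g" and h: "skb_hom (T_obj B) A h"
    and eq: "\<And>x. x \<in> carrier B \<Longrightarrow> g (gen B x) = h (gen B x)"
    and X: "X \<in> carrier (T_obj B)"
  shows "g X = h X"
proof -
  interpret g: skb_hom "T_obj B" A g by fact
  interpret h: skb_hom "T_obj B" A h by fact
  show ?thesis
    using free_lift_unique[OF g.cod.skew_brace g.hom[unfolded T_obj_def], of "\<lambda>x. h (gen B x)" X]
      free_lift_unique[OF g.cod.skew_brace h.hom[unfolded T_obj_def], of "\<lambda>x. h (gen B x)" X]
      eq X by (simp add: T_obj_def)
qed

lemma T_map_hom:
  assumes "f \<in> carrier B \<rightarrow> carrier C"
  shows "skb_hom (T_obj B) (T_obj C) (T_map C f)"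
proof -
  have "(\<lambda>x. gen C (f x)) \<in> carrier B \<rightarrow> carrier (T_obj C)"
    using assms by (auto intro: gen_closed)
  from free_lift_hom[OF skew_brace_T_obj this] show ?thesis
    unfolding T_map_def by (intro skb_homI skew_brace_T_obj) (simp add: T_obj_def)
qed

lemma T_map_gen:
  assumes "f \<in> carrier B \<rightarrow> carrier C" "x \<in> carrier B"
  shows "T_map C f (gen B x) = gen C (f x)"
proof -
  have "(\<lambda>x. gen C (f x)) \<in> carrier B \<rightarrow> carrier (T_obj C)"
    using assms by (auto intro: gen_closed)
  from free_lift_unit[OF skew_brace_T_obj this assms(2)] show ?thesis by (simp add: T_map_def)
qed

lemma T_counit_hom:
  assumes "skew_brace B"
  shows "skb_hom (T_obj B) B (T_counit B)"
  using free_lift_hom[OF assms, of "\<lambda>x. x" "carrier B"] assms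
  by (intro skb_homI skew_brace_T_obj) (simp_all add: T_obj_def T_counit_def)

lemma T_counit_gen: "\<lbrakk>skew_brace B; x \<in> carrier B\<rbrakk> \<Longrightarrow> T_counit B (gen B x) = x"
  unfolding T_counit_def by (rule free_lift_unit) auto

lemma skb_hom_funcset: "skb_hom A C f \<Longrightarrow> f \<in> carrier A \<rightarrow> carrier C"
  by (auto intro: skb_hom.f_closed)

lemma truncated_resolution_T:
  assumes B: "skew_brace B"
  shows "truncated_resolution (T_obj B) (T_obj (T_obj B)) (T_obj (T_obj (T_obj B)))
    (T_face1 B 0) (T_face1 B 1) (T_face2 B 0) (T_face2 B 1) (T_face2 B 2)
    (T_map (T_obj B) (gen B)) (a_kernel (T_obj B) B (T_counit B))"
proof -
  define X0 where "X0 = T_obj B"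
  define X1 where "X1 = T_obj X0"
  define X2 where "X2 = T_obj X1"
  define p where "p = T_counit B"
  define d0 where "d0 = T_counit X0"
  define d1 where "d1 = T_map B p"
  define e0 where "e0 = T_counit X1"
  define e1 where "e1 = T_map X0 d0"
  define e2 where "e2 = T_map X0 d1"
  \<comment> \<open>\<open>s\<close> is the comultiplication of the comonad at \<open>B\<close>,
    \<open>t0\<close> is that at \<open>X0\<close>, and \<open>t1\<close> is \<open>s\<close> with
    the free functor applied; they serve as degeneracies.\<close>
  define s where "s = T_map X0 (gen B)"
  define t0 where "t0 = T_map X1 (gen X0)"
  define t1 where "t1 = T_map X1 s"
  define K where "K = a_kernel X0 B p"
  have skb: "skew_brace X0" "skew_brace X1" "skew_brace X2"
    by (simp_all add: X0_def X1_def X2_def skew_brace_T_obj)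
  note funcset = skb_hom_funcset
  have p: "skb_hom X0 B p" unfolding X0_def p_def by (rule T_counit_hom[OF B])
  have d0: "skb_hom X1 X0 d0" unfolding X1_def d0_def by (rule T_counit_hom[OF skb(1)])
  have d1: "skb_hom X1 X0 d1"
    using T_map_hom[OF funcset[OF p]] by (simp only: X0_def[symmetric] X1_def[symmetric] d1_def[symmetric])
  have e0: "skb_hom X2 X1 e0" unfolding X2_def e0_def by (rule T_counit_hom[OF skb(2)])
  have e1: "skb_hom X2 X1 e1"
    using T_map_hom[OF funcset[OF d0]] by (simp only: X1_def[symmetric] X2_def[symmetric] e1_def[symmetric])
  have e2: "skb_hom X2 X1 e2"
    using T_map_hom[OF funcset[OF d1]] by (simp only: X1_def[symmetric] X2_def[symmetric] e2_def[symmetric])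
  have g0: "gen B \<in> carrier B \<rightarrow> carrier X0" "gen X0 \<in> carrier X0 \<rightarrow> carrier X1"
    "gen X1 \<in> carrier X1 \<rightarrow> carrier X2"
    by (simp_all add: X0_def X1_def X2_def gen_closed)
  have s: "skb_hom X0 X1 s"
    using T_map_hom[OF g0(1)] by (simp only: X0_def[symmetric] X1_def[symmetric] s_def[symmetric])
  have t0: "skb_hom X1 X2 t0"
    using T_map_hom[OF g0(2)] by (simp only: X1_def[symmetric] X2_def[symmetric] t0_def[symmetric])
  have t1: "skb_hom X1 X2 t1"
    using T_map_hom[OF funcset[OF s]] by (simp only: X1_def[symmetric] X2_def[symmetric] t1_def[symmetric])
  interpret p: skb_hom X0 B p by fact
  interpret d0: skb_hom X1 X0 d0 by fact
  interpret d1: skb_hom X1 X0 d1 by fact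
  interpret e0: skb_hom X2 X1 e0 by fact
  interpret e1: skb_hom X2 X1 e1 by fact
  interpret e2: skb_hom X2 X1 e2 by fact
  interpret s: skb_hom X0 X1 s by fact
  interpret t0: skb_hom X1 X2 t0 by fact
  interpret t1: skb_hom X1 X2 t1 by fact
  have gcl [simp]: "x \<in> carrier B \<Longrightarrow> gen B x \<in> carrier X0"
    "y \<in> carrier X0 \<Longrightarrow> gen X0 y \<in> carrier X1" "z \<in> carrier X1 \<Longrightarrow> gen X1 z \<in> carrier X2" for x y z
    using g0 by auto
  have pg [simp]: "p (gen B x) = x" if "x \<in> carrier B" for x
    using that by (simp add: p_def T_counit_gen B)
  have d0g [simp]: "d0 (gen X0 x) = x" if "x \<in> carrier X0" for x
    using that by (simp add: d0_def T_counit_gen skb)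
  have e0g [simp]: "e0 (gen X1 x) = x" if "x \<in> carrier X1" for x
    using that by (simp add: e0_def T_counit_gen skb)
  have d1g [simp]: "d1 (gen X0 x) = gen B (p x)" if "x \<in> carrier X0" for x
    using T_map_gen[OF funcset[OF p] that] by (simp add: d1_def)
  have e1g [simp]: "e1 (gen X1 x) = gen X0 (d0 x)" if "x \<in> carrier X1" for x
    using T_map_gen[OF funcset[OF d0] that] by (simp add: e1_def)
  have e2g [simp]: "e2 (gen X1 x) = gen X0 (d1 x)" if "x \<in> carrier X1" for x
    using T_map_gen[OF funcset[OF d1] that] by (simp add: e2_def)
  have sg [simp]: "s (gen B x) = gen X0 (gen B x)" if "x \<in> carrier B" for x
    using T_map_gen[OF g0(1) that] by (simp add: s_def)
  have t0g [simp]: "t0 (gen X0 x) = gen X1 (gen X0 x)" if "x \<in> carrier X0" for x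
    using T_map_gen[OF g0(2) that] by (simp add: t0_def)
  have t1g [simp]: "t1 (gen X0 x) = gen X1 (s x)" if "x \<in> carrier X0" for x
    using T_map_gen[OF funcset[OF s] that] by (simp add: t1_def)
  note id = skb_hom_ident[OF skb(1)] skb_hom_ident[OF skb(2)]
  note eq0 = T_hom_eqI[of B, folded X0_def] and eq1 = T_hom_eqI[of X0, folded X1_def]
    and eq2 = T_hom_eqI[of X1, folded X2_def]
  have p_d: "p (d1 u) = p (d0 u)" if "u \<in> carrier X1" for u
    by (rule eq1[OF skb_hom_comp[OF d1 p] skb_hom_comp[OF d0 p] _ that]) simp
  have d0_s: "d0 (s x) = x" if "x \<in> carrier X0" for x
    by (rule eq0[OF skb_hom_comp[OF s d0] id(1) _ that]) simp
  have d1_s: "d1 (s x) = x" if "x \<in> carrier X0" for x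
    by (rule eq0[OF skb_hom_comp[OF s d1] id(1) _ that]) simp
  have e0_t0: "e0 (t0 x) = x" if "x \<in> carrier X1" for x
    by (rule eq1[OF skb_hom_comp[OF t0 e0] id(2) _ that]) simp
  have e1_t0: "e1 (t0 x) = x" if "x \<in> carrier X1" for x
    by (rule eq1[OF skb_hom_comp[OF t0 e1] id(2) _ that]) simp
  have e2_t0: "e2 (t0 x) = s (d1 x)" if "x \<in> carrier X1" for x
    by (rule eq1[OF skb_hom_comp[OF t0 e2] skb_hom_comp[OF d1 s] _ that]) simp
  have e0_t1: "e0 (t1 x) = s (d0 x)" if "x \<in> carrier X1" for x
    by (rule eq1[OF skb_hom_comp[OF t1 e0] skb_hom_comp[OF d0 s] _ that]) simp
  have e1_t1: "e1 (t1 x) = x" if "x \<in> carrier X1" for x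
    by (rule eq1[OF skb_hom_comp[OF t1 e1] id(2) _ that]) (simp add: d0_s)
  have e2_t1: "e2 (t1 x) = x" if "x \<in> carrier X1" for x
    by (rule eq1[OF skb_hom_comp[OF t1 e2] id(2) _ that]) (simp add: d1_s)
  have d0_e1: "d0 (e1 w) = d0 (e0 w)" if "w \<in> carrier X2" for w
    by (rule eq2[OF skb_hom_comp[OF e1 d0] skb_hom_comp[OF e0 d0] _ that]) simp
  have d1_e2: "d1 (e2 w) = d1 (e1 w)" if "w \<in> carrier X2" for w
    by (rule eq2[OF skb_hom_comp[OF e2 d1] skb_hom_comp[OF e1 d1] _ that]) (simp add: p_d)
  have d0_e2: "d0 (e2 w) = d1 (e0 w)" if "w \<in> carrier X2" for w
    by (rule eq2[OF skb_hom_comp[OF e2 d0] skb_hom_comp[OF e0 d1] _ that]) simp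
  have "skb_ideal X0 K"
    using p.ideal_vimage[OF p.cod.zero_ideal] by (simp add: K_def a_kernel_def kernel_def)
  then have K: "skb_with_ideal X0 K"
    using skb(1) by (simp add: skb_with_ideal_def skb_with_ideal_axioms_def skb_def)
  have memK: "x \<in> K \<longleftrightarrow> x \<in> carrier X0 \<and> p x = \<zero>\<^bsub>B\<^esub>" for x by (simp add: K_def mem_a_kernel)
  have "truncated_resolution X0 X1 X2 d0 d1 e0 e1 e2 s K"
  proof (intro truncated_resolution.intro truncated_resolution_axioms.intro d0 d1 e0 e1 e2 s K
      d0_s d1_s d0_e1 d1_e2 d0_e2 skb[THEN skb.intro])
    show "d1 u \<ominus>\<^bsub>X0\<^esub> d0 u \<in> K" if "u \<in> carrier X1" for u
      using that by (simp add: memK p_d a_minus_def)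
  next
    fix k assume k: "k \<in> K"
    \<comment> \<open>Under \<open>d0\<close> this gives k - k + 0. Under \<open>d1\<close> the
      second term becomes \<open>gen B\<close> of \<open>p k\<close>, that is of zero; as
      \<open>gen\<close> does not send zero to zero, the last term is added to cancel it.\<close>
    let ?u = "s k \<oplus>\<^bsub>X1\<^esub> (\<ominus>\<^bsub>X1\<^esub> gen X0 k \<oplus>\<^bsub>X1\<^esub> gen X0 \<zero>\<^bsub>X0\<^esub>)"
    have "?u \<in> carrier X1" "d0 ?u = \<zero>\<^bsub>X0\<^esub>" "d1 ?u = k"
      using k by (simp_all add: memK d0_s d1_s)
    then show "\<exists>u\<in>carrier X1. d0 u = \<zero>\<^bsub>X0\<^esub> \<and> d1 u = k" by blast
  next
    fix u assume u: "u \<in> carrier X1" "d0 u = \<zero>\<^bsub>X0\<^esub>" "d1 u = \<zero>\<^bsub>X0\<^esub>"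
    txt \<open>\<open>gen X1 u - gen X1 0\<close> has faces \<open>u, 0, 0\<close>; the degeneracies shift them to \<open>0, 0, u\<close>.\<close>
    let ?w = "t1 u \<oplus>\<^bsub>X2\<^esub> (\<ominus>\<^bsub>X2\<^esub> t0 u \<oplus>\<^bsub>X2\<^esub> (gen X1 u \<oplus>\<^bsub>X2\<^esub> \<ominus>\<^bsub>X2\<^esub> gen X1 \<zero>\<^bsub>X1\<^esub>))"
    have "?w \<in> carrier X2" "e0 ?w = \<zero>\<^bsub>X1\<^esub>" "e1 ?w = \<zero>\<^bsub>X1\<^esub>" "e2 ?w = u"
      using u by (simp_all add: e0_t0 e1_t0 e2_t0 e0_t1 e1_t1 e2_t1)
    then show "\<exists>w\<in>carrier X2. e0 w = \<zero>\<^bsub>X1\<^esub> \<and> e1 w = \<zero>\<^bsub>X1\<^esub> \<and> e2 w = u" by blast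
  qed
  moreover have "T_face1 B 0 = d0" "T_face1 B 1 = d1" "T_face2 B 0 = e0" "T_face2 B 1 = e1"
    "T_face2 B 2 = e2"
    by (simp_all add: T_face1_def T_face2_def d0_def d1_def e0_def e1_def e2_def X0_def X1_def p_def)
  ultimately show ?thesis by (simp only: X0_def X1_def X2_def s_def K_def p_def)
qed

theorem mainTheorem10:
  fixes B :: "'a ring"
    and P :: "'a skb_term set ring"
    and p :: "'a skb_term set \<Rightarrow> 'a"
    and K :: "'a skb_term set set"
  assumes "skew_brace B"
    and "P = free_skb (carrier B)"
    and "p = T_counit B"
    and "K = a_kernel P B p"
  shows "radrng_iso (H2_radrng B)
           (P\<lparr>carrier := K \<inter> radrng_commutator P (carrier P)\<rparr> Quot radrng_commutator P K)"
  unfolding H2_radrng_def assms(2-4) T_obj_def[symmetric]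
  by (rule truncated_resolution.hopf_formula[OF truncated_resolution_T[OF assms(1)]])
    simp_all

end
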